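(* Let $m = m(n) = e^{-f(n)} n$ where $f(n) \big/ \left(\frac{\log n}{\log\log n}\right)^{1/2} \to 0$ as $n \to \infty$. Then $\mathbf{RT}(n,K_4,m) \ge \left(\frac18 - o(1)\right) n^2$, where $o(1)\to 0$ as $n\to\infty$.
   Context: For a graph $H$ and positive integers $n,m$, the Ramsey–Turán number $\mathbf{RT}(n,H,m)$ is the maximum number of edges in a graph on $n$ vertices with independence number less than $m$ that contains no copy of $H$ as a subgraph. Logarithms are natural. *)

theory Defs
  imports Complex_Main "HOL-Library.Ramsey"
begin

type_synonym 'a ugraph = "'a set \<times> 'a set set"

definition verts :: "'a ugraph \<Rightarrow> 'a set" where
  "verts G = fst G"

definition edges :: "'a ugraph \<Rightarrow> 'a set set" where
  "edges G = snd G"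

definition finite_simple_graph :: "'a ugraph \<Rightarrow> bool" where
  "finite_simple_graph G \<longleftrightarrow> finite (verts G) \<and> edges G \<subseteq> [verts G]\<^bsup>2\<^esup>"

definition complete_graph :: "nat \<Rightarrow> nat ugraph" where
  "complete_graph k = ({..<k}, [{..<k}]\<^bsup>2\<^esup>)"

text \<open>Copies are not required to be induced.\<close>

definition contains_copy :: "'b ugraph \<Rightarrow> 'a ugraph \<Rightarrow> bool" where
  "contains_copy G H \<longleftrightarrow>
     (\<exists>\<phi>. inj_on \<phi> (verts H) \<and> \<phi> ` verts H \<subseteq> verts G \<and> (\<forall>e\<in>edges H. \<phi> ` e \<in> edges G))"

definition independence_number :: "'a ugraph \<Rightarrow> nat" where
  "independence_number G = Max {card S |S. S \<subseteq> verts G \<and> indep S (edges G)}"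

text \<open>Up to isomorphism every finite graph has its vertices in \<^typ>\<open>nat\<close>. The set of edge counts
  is bounded by \<open>n choose 2\<close>; it is empty, and the value then unspecified, exactly when
  there is no admissible graph (for instance if \<open>m = 0\<close>).\<close>

definition RT :: "nat \<Rightarrow> 'a ugraph \<Rightarrow> nat \<Rightarrow> nat" where
  "RT n H m = Max {card (edges G) |G :: nat ugraph.
     finite_simple_graph G \<and> card (verts G) = n \<and> independence_number G < m \<and> \<not> contains_copy G H}"

end

theory Submission
  imports Defs "HOL-Analysis.Analysis" "HOL-Real_Asymp.Real_Asymp"
begin

text \<open>
  The graph is a discrete variant of the Bollobas--Erdos graph in which the uniform measure
  on the sphere is replaced by the Gaussian weight \<open>exp (- |x|\<^sup>2 / (2 s\<^sup>2))\<close> on an integer cube.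
  Each side of a bipartition carries one copy of the points, blown up in proportion to their weight.
  Points \<open>x, x'\<close> on the same side are joined if \<open>|x + x'|\<^sup>2 \<le> t\<close>, points \<open>x, y\<close> on different sides
  if \<open>\<langle>x, y\<rangle> > t / 4\<close>. A \<open>K\<^sub>4\<close> with two vertices on each side is impossible since then
  \<open>t < \<langle>x + x', y + y'\<rangle> \<le> t\<close>, and three vertices on one side would force \<open>4 |x|\<^sup>2 \<le> 9 t\<close>,
  so points of small norm are discarded.

  If \<open>A\<close> is independent in one side, then \<open>A\<close> and \<open>- A\<close> are at distance at least \<open>t\<^sup>1\<^sup>/\<^sup>2\<close>; a discrete
  Prekopa--Leindler inequality, applied to the strongly log-concave weight, bounds the mass of \<open>A\<close>
  by a constant times \<open>exp (- t / (8 s\<^sup>2))\<close>. In dimension \<open>k\<close> with \<open>t\<close> a small multiple of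
  \<open>s\<^sup>2 k\<^sup>1\<^sup>/\<^sup>2\<close>, the slab \<open>|\<langle>x, y\<rangle>| \<le> t / 4\<close> has small mass, because it has many disjoint translates
  of comparable mass; by symmetry almost half of all cross pairs are edges. Since the cube has
  \<open>k\<^sup>O\<^sup>(\<^sup>k\<^sup>)\<close> points, \<open>k\<close> can be taken of order \<open>log n / log log n\<close>.
\<close>

section \<open>A discrete Prekopa--Leindler inequality\<close>

text \<open>The translates \<open>A + Min B\<close> and \<open>Max A + B + 1\<close> both lie in
  \<open>C\<close>, and they are disjoint because everything in the first is at most
  \<open>Max A + Min B\<close>. The shift \<open>e = 1\<close> is what separates them at that common
  point.\<close>

lemma card_sumset_int:
  fixes A B C :: "int set"
  assumes fin: "finite A" "finite B" "finite C" and ne: "A \<noteq> {}" "B \<noteq> {}"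
    and sub: "\<And>a b e. a \<in> A \<Longrightarrow> b \<in> B \<Longrightarrow> e \<in> {0, 1} \<Longrightarrow> a + b + e \<in> C"
  shows "card A + card B \<le> card C"
proof -
  let ?X = "(\<lambda>a. a + Min B) ` A" and ?Y = "(\<lambda>b. Max A + b + 1) ` B"
  have "card ?X = card A" "card ?Y = card B"
    by (auto intro!: card_image inj_onI)
  moreover have "?X \<inter> ?Y = {}"
  proof -
    have "a + Min B < Max A + b + 1" if "a \<in> A" "b \<in> B" for a b
      using Max_ge[OF fin(1) that(1)] Min_le[OF fin(2) that(2)] by linarith
    then show ?thesis by fastforce
  qed
  moreover have "?X \<union> ?Y \<subseteq> C"
    using sub[of _ "Min B" 0] sub[of "Max A" _ 1] fin ne by auto
  ultimately show ?thesis
    using card_mono[OF fin(3), of "?X \<union> ?Y"] card_Un_disjoint[of ?X ?Y] fin by simp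
qed

text \<open>Each value \<open>f a\<close> is the length of the set of levels \<open>l\<close> below
  it. This reduces inequalities between sums to inequalities between cardinalities of superlevel
  sets.\<close>

lemma layer_cake_unit:
  fixes f :: "'a \<Rightarrow> real"
  assumes "finite S" "\<And>a. a \<in> S \<Longrightarrow> 0 \<le> f a" "\<And>a. a \<in> S \<Longrightarrow> f a \<le> 1"
  shows "((\<lambda>l. real (card {a \<in> S. l \<le> f a})) has_integral sum f S) {0..1}"
proof -
  have one: "((\<lambda>l. if l \<le> c then 1 else 0) has_integral c) {0..1}" if "0 \<le> c" "c \<le> 1" for c :: real
  proof -
    have "((\<lambda>l. if l \<in> {0..c} then 1 else 0) has_integral c) {0..(1::real)}"
      using that has_integral_const_real[of "1::real" 0 c] by (subst has_integral_restrict) auto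
    then show ?thesis
      by (rule has_integral_eq[rotated]) auto
  qed
  have "((\<lambda>l. \<Sum>a\<in>S. if l \<le> f a then 1 else 0) has_integral sum f S) {0..(1::real)}"
    using assms by (intro has_integral_sum one) auto
  moreover have "(\<Sum>a\<in>S. if l \<le> f a then 1 else 0) = real (card {a \<in> S. l \<le> f a})" for l
    using assms(1) by (simp add: sum.If_cases Int_def)
  ultimately show ?thesis by simp
qed

text \<open>The correction \<open>e \<in> {0, 1}\<close> compensates for \<open>|A + B| \<ge> |A| + |B| - 1\<close> being the best
  possible bound on sumsets of integers.\<close>

lemma sum_sup_convolution_int:
  fixes f g h :: "int \<Rightarrow> real"
  assumes fin: "finite S" "finite T"
    and nonneg: "\<And>a. a \<in> S \<Longrightarrow> 0 \<le> f a" "\<And>a. a \<in> S \<Longrightarrow> 0 \<le> g a" "\<And>a. a \<in> T \<Longrightarrow> 0 \<le> h a"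
    and sub: "\<And>a b e. a \<in> S \<Longrightarrow> b \<in> S \<Longrightarrow> e \<in> {0, 1} \<Longrightarrow> a + b + e \<in> T"
    and le: "\<And>a b e. a \<in> S \<Longrightarrow> b \<in> S \<Longrightarrow> e \<in> {0, 1} \<Longrightarrow> f a * g b \<le> (h (a + b + e))\<^sup>2"
  shows "4 * (sum f S * sum g S) \<le> (sum h T)\<^sup>2"
proof (cases "sum f S = 0 \<or> sum g S = 0")
  case True
  then show ?thesis by auto
next
  case False
  then have S: "S \<noteq> {}" by auto
  \<comment> \<open>Dividing by the maxima makes the superlevel sets of both functions nonempty for
    every level in \<open>{0..1}\<close>, as the sumset bound requires.\<close>
  define \<alpha> where "\<alpha> = Max (f ` S)"
  define \<beta> where "\<beta> = Max (g ` S)"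
  obtain a0 where a0: "a0 \<in> S" "f a0 = \<alpha>"
  proof -
    have "Max (f ` S) \<in> f ` S" using fin S by simp
    then show thesis using that unfolding \<alpha>_def by fastforce
  qed
  obtain b0 where b0: "b0 \<in> S" "g b0 = \<beta>"
  proof -
    have "Max (g ` S) \<in> g ` S" using fin S by simp
    then show thesis using that unfolding \<beta>_def by fastforce
  qed
  have le_\<alpha>: "f a \<le> \<alpha>" and le_\<beta>: "g a \<le> \<beta>" if "a \<in> S" for a
    using that fin unfolding \<alpha>_def \<beta>_def by auto
  have "\<alpha> \<noteq> 0"
  proof
    assume "\<alpha> = 0"
    then have "\<forall>a\<in>S. f a = 0" using le_\<alpha> nonneg(1) by (auto intro: order_antisym)
    then show False using False by simp
  qed
  then have \<alpha>: "\<alpha> > 0" using a0 nonneg(1) by fastforce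
  have "\<beta> \<noteq> 0"
  proof
    assume "\<beta> = 0"
    then have "\<forall>a\<in>S. g a = 0" using le_\<beta> nonneg(2) by (auto intro: order_antisym)
    then show False using False by simp
  qed
  then have \<beta>: "\<beta> > 0" using b0 nonneg(2) by fastforce
  define r where "r = sqrt (\<alpha> * \<beta>)"
  have r: "r > 0" "r\<^sup>2 = \<alpha> * \<beta>" using \<alpha> \<beta> by (auto simp: r_def)
  define F where "F a = f a / \<alpha>" for a
  define G where "G a = g a / \<beta>" for a
  \<comment> \<open>The truncation puts \<open>H\<close> in the range of the layer cake formula; it
    only decreases the sum that has to be large.\<close>
  define H where "H a = min 1 (h a / r)" for a
  have F: "((\<lambda>l. real (card {a \<in> S. l \<le> F a})) has_integral sum F S) {0..1}"
    using fin nonneg \<alpha> le_\<alpha> by (intro layer_cake_unit) (auto simp: F_def)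
  have G: "((\<lambda>l. real (card {a \<in> S. l \<le> G a})) has_integral sum G S) {0..1}"
    using fin nonneg \<beta> le_\<beta> by (intro layer_cake_unit) (auto simp: G_def)
  have H: "((\<lambda>l. real (card {a \<in> T. l \<le> H a})) has_integral sum H T) {0..1}"
    using fin nonneg r by (intro layer_cake_unit) (auto simp: H_def)
  have "sum F S + sum G S \<le> sum H T"
  proof (rule has_integral_le[OF has_integral_add[OF F G] H])
    fix l :: real assume l: "l \<in> {0..1}"
    have "card {a \<in> S. l \<le> F a} + card {a \<in> S. l \<le> G a} \<le> card {a \<in> T. l \<le> H a}"
    proof (rule card_sumset_int)
      have "F a0 = 1" "G b0 = 1" using a0 b0 \<alpha> \<beta> by (auto simp: F_def G_def)
      then show "{a \<in> S. l \<le> F a} \<noteq> {}" "{a \<in> S. l \<le> G a} \<noteq> {}" using a0 b0 l by auto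
    next
      fix a b e :: int
      assume *: "a \<in> {a \<in> S. l \<le> F a}" "b \<in> {a \<in> S. l \<le> G a}" "e \<in> {0, 1}"
      have "l\<^sup>2 \<le> F a * G b" using * l unfolding power2_eq_square by (intro mult_mono) auto
      also have "\<dots> \<le> (h (a + b + e) / r)\<^sup>2"
        using le[of a b e] * r \<alpha> \<beta> unfolding F_def G_def
        by (simp add: power_divide divide_right_mono)
      finally have "l \<le> h (a + b + e) / r"
        by (rule power2_le_imp_le) (use sub[of a b e] nonneg(3) * r in auto)
      then show "a + b + e \<in> {a \<in> T. l \<le> H a}" using sub[of a b e] * l by (auto simp: H_def)
    qed (use fin in auto)
    then show "real (card {a \<in> S. l \<le> F a}) + real (card {a \<in> S. l \<le> G a}) \<le> real (card {a \<in> T. l \<le> H a})"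
      by linarith
  qed
  also have "\<dots> \<le> sum h T / r"
    unfolding sum_divide_distrib by (intro sum_mono) (auto simp: H_def)
  finally have le1: "sum f S / \<alpha> + sum g S / \<beta> \<le> sum h T / r"
    unfolding F_def G_def sum_divide_distrib .
  have nn: "sum f S \<ge> 0" "sum g S \<ge> 0" using nonneg by (auto intro: sum_nonneg)
  \<comment> \<open>The additive inequality for the normalised functions becomes multiplicative, so
    that it can be iterated over coordinates.\<close>
  have amgm: "4 * (u * v) \<le> (u + v)\<^sup>2" for u v :: real
    using zero_le_power2[of "u - v"] by (simp add: power2_eq_square algebra_simps)
  have "4 * (sum f S / \<alpha> * (sum g S / \<beta>)) \<le> (sum f S / \<alpha> + sum g S / \<beta>)\<^sup>2"
    by (rule amgm)
  also have "\<dots> \<le> (sum h T / r)\<^sup>2"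
    using le1 nn \<alpha> \<beta> by (intro power_mono) auto
  also have "\<dots> = (sum h T)\<^sup>2 / (\<alpha> * \<beta>)" using r by (simp add: power_divide)
  finally show ?thesis using \<alpha> \<beta> by (simp add: field_simps)
qed

text \<open>Coordinates from \<open>k\<close> on are zero, so boxes of all dimensions share one type
  and \<open>x(k := a)\<close> passes from dimension \<open>k\<close> to
  \<open>k + 1\<close>.\<close>

definition lattice_box :: "int set \<Rightarrow> nat \<Rightarrow> (nat \<Rightarrow> int) set" where
  "lattice_box S k = {x. (\<forall>i<k. x i \<in> S) \<and> (\<forall>i\<ge>k. x i = 0)}"

lemma lattice_box_0: "lattice_box S 0 = {\<lambda>_. 0}"
  by (auto simp: lattice_box_def)

lemma lattice_box_Suc:
  "lattice_box S (Suc k) = (\<lambda>(a, x). x(k := a)) ` (S \<times> lattice_box S k)" (is "?L = ?R")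
proof
  show "?L \<subseteq> ?R"
  proof
    fix x assume "x \<in> ?L"
    then have "x = (\<lambda>(a, x). x(k := a)) (x k, x(k := 0))" "(x k, x(k := 0)) \<in> S \<times> lattice_box S k"
      by (auto simp: lattice_box_def le_Suc_eq)
    then show "x \<in> ?R" by (rule image_eqI)
  qed
qed (auto simp: lattice_box_def less_Suc_eq)

lemma inj_on_lattice_box_upd: "inj_on (\<lambda>(a, x). x(k := a)) (S \<times> lattice_box S k)"
proof (rule inj_onI, clarify)
  fix a b x y
  assume xy: "x \<in> lattice_box S k" "y \<in> lattice_box S k" and eq: "x(k := a) = y(k := b)"
  have "x i = y i" for i
    using fun_cong[OF eq, of i] xy by (cases "i = k") (auto simp: lattice_box_def)
  with fun_cong[OF eq, of k] show "a = b \<and> x = y" by auto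
qed

lemma sum_lattice_box_Suc:
  "(\<Sum>x\<in>lattice_box S (Suc k). f x) = (\<Sum>a\<in>S. \<Sum>x\<in>lattice_box S k. f (x(k := a)))"
  unfolding lattice_box_Suc sum.reindex[OF inj_on_lattice_box_upd]
  by (simp add: sum.cartesian_product case_prod_beta' comp_def)

lemma finite_lattice_box [simp]: "finite S \<Longrightarrow> finite (lattice_box S k)"
  by (induction k) (auto simp: lattice_box_0 lattice_box_Suc)

lemma card_lattice_box: "finite S \<Longrightarrow> card (lattice_box S k) = card S ^ k"
  by (induction k) (auto simp: lattice_box_0 lattice_box_Suc card_image[OF inj_on_lattice_box_upd] card_cartesian_product)

lemma sum_prod_lattice_box:
  fixes g :: "nat \<Rightarrow> int \<Rightarrow> real"
  shows "(\<Sum>x\<in>lattice_box S k. \<Prod>i<k. g i (x i)) = (\<Prod>i<k. sum (g i) S)"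
proof (induction k)
  case (Suc k)
  have "(\<Prod>i<k. g i ((x(k := a)) i)) = (\<Prod>i<k. g i (x i))" for x :: "nat \<Rightarrow> int" and a
    by (intro prod.cong) auto
  then show ?case
    by (simp add: sum_lattice_box_Suc Suc.IH flip: sum_distrib_right sum_distrib_left)
qed (simp add: lattice_box_0)

text \<open>Induction on the dimension: the hypothesis for the slices with fixed last coordinate is
  exactly the pointwise condition that the one-dimensional inequality needs for the slice
  sums.\<close>

lemma sum_sup_convolution_lattice_box:
  fixes f g h :: "(nat \<Rightarrow> int) \<Rightarrow> real"
  assumes fin: "finite S" "finite T"
    and sub: "\<And>a b e. a \<in> S \<Longrightarrow> b \<in> S \<Longrightarrow> e \<in> {0, 1} \<Longrightarrow> a + b + e \<in> T"
    and nonneg: "\<And>x. x \<in> lattice_box S k \<Longrightarrow> 0 \<le> f x" "\<And>x. x \<in> lattice_box S k \<Longrightarrow> 0 \<le> g x"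
      "\<And>x. x \<in> lattice_box T k \<Longrightarrow> 0 \<le> h x"
    and le: "\<And>x y e. x \<in> lattice_box S k \<Longrightarrow> y \<in> lattice_box S k \<Longrightarrow> e \<in> lattice_box {0, 1} k \<Longrightarrow>
      f x * g y \<le> (h (\<lambda>i. x i + y i + e i))\<^sup>2"
  shows "4 ^ k * (sum f (lattice_box S k) * sum g (lattice_box S k)) \<le> (sum h (lattice_box T k))\<^sup>2"
  using nonneg le
proof (induction k arbitrary: f g h)
  case 0
  from 0(4)[of "\<lambda>_. 0" "\<lambda>_. 0" "\<lambda>_. 0"] show ?case by (simp add: lattice_box_0)
next
  case (Suc k)
  have upd: "x(k := a) \<in> lattice_box A (Suc k)" if "x \<in> lattice_box A k" "a \<in> A" for x a A
    using that unfolding lattice_box_Suc by auto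
  \<comment> \<open>The factor \<open>4 ^ k\<close> from the induction hypothesis is absorbed into
    the first of the two one-dimensional functions.\<close>
  have "4 * (sum (\<lambda>a. 4 ^ k * (\<Sum>x\<in>lattice_box S k. f (x(k := a)))) S
          * sum (\<lambda>a. \<Sum>x\<in>lattice_box S k. g (x(k := a))) S)
      \<le> (sum (\<lambda>a. \<Sum>x\<in>lattice_box T k. h (x(k := a))) T)\<^sup>2"
  proof (rule sum_sup_convolution_int[OF fin _ _ _ sub])
    fix a b e :: int assume ab: "a \<in> S" "b \<in> S" "e \<in> {0, 1}"
    have "4 ^ k * ((\<Sum>x\<in>lattice_box S k. f (x(k := a))) * (\<Sum>x\<in>lattice_box S k. g (x(k := b))))
        \<le> (\<Sum>x\<in>lattice_box T k. h (x(k := a + b + e)))\<^sup>2"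
    proof (rule Suc.IH[of "\<lambda>x. f (x(k := a))" "\<lambda>x. g (x(k := b))" "\<lambda>x. h (x(k := a + b + e))"])
      fix x y d assume xyd: "x \<in> lattice_box S k" "y \<in> lattice_box S k" "d \<in> lattice_box {0, 1} k"
      have "(\<lambda>i. (x(k := a)) i + (y(k := b)) i + (d(k := e)) i) = (\<lambda>i. x i + y i + d i)(k := a + b + e)"
        by auto
      then show "f (x(k := a)) * g (y(k := b)) \<le> (h ((\<lambda>i. x i + y i + d i)(k := a + b + e)))\<^sup>2"
        using Suc.prems(4)[OF upd[OF xyd(1) ab(1)] upd[OF xyd(2) ab(2)] upd[OF xyd(3) ab(3)]] by (simp only:)
    qed (blast intro: Suc.prems(1-3) upd ab sub[OF ab])+
    then show "4 ^ k * (\<Sum>x\<in>lattice_box S k. f (x(k := a))) * (\<Sum>x\<in>lattice_box S k. g (x(k := b)))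
        \<le> (\<Sum>x\<in>lattice_box T k. h (x(k := a + b + e)))\<^sup>2" by (simp add: mult.assoc)
  qed (blast intro: Suc.prems(1-3) upd sum_nonneg mult_nonneg_nonneg zero_le_power zero_le_numeral)+
  then show ?case
    unfolding sum_lattice_box_Suc sum_distrib_left[symmetric] by (simp only: power_Suc mult.assoc)
qed

section \<open>Gaussian weights on integer cubes\<close>

definition sq_norm :: "nat \<Rightarrow> (nat \<Rightarrow> int) \<Rightarrow> int" where
  "sq_norm k x = (\<Sum>i<k. (x i)\<^sup>2)"

definition dot :: "nat \<Rightarrow> (nat \<Rightarrow> int) \<Rightarrow> (nat \<Rightarrow> int) \<Rightarrow> int" where
  "dot k x y = (\<Sum>i<k. x i * y i)"

definition gauss1 :: "real \<Rightarrow> int \<Rightarrow> real" where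
  "gauss1 s a = exp (- (real_of_int a)\<^sup>2 / (2 * s\<^sup>2))"

definition gauss :: "real \<Rightarrow> nat \<Rightarrow> (nat \<Rightarrow> int) \<Rightarrow> real" where
  "gauss s k x = (\<Prod>i<k. gauss1 s (x i))"

definition gauss_mass :: "real \<Rightarrow> nat \<Rightarrow> real" where
  "gauss_mass s m = (\<Sum>a = - int m..int m. gauss1 s a)"

abbreviation cube :: "nat \<Rightarrow> nat \<Rightarrow> (nat \<Rightarrow> int) set" where
  "cube m k \<equiv> lattice_box {- int m..int m} k"

lemma gauss1_pos: "gauss1 s a > 0"
  by (simp add: gauss1_def)

lemma gauss1_le_1: "gauss1 s a \<le> 1"
  by (simp add: gauss1_def)

lemma gauss1_uminus: "gauss1 s (- a) = gauss1 s a"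
  by (simp add: gauss1_def)

lemma gauss_pos: "gauss s k x > 0"
  by (simp add: gauss_def gauss1_pos prod_pos)

lemma gauss_eq_exp: "gauss s k x = exp (- real_of_int (sq_norm k x) / (2 * s\<^sup>2))"
  by (simp add: gauss_def gauss1_def sq_norm_def sum_divide_distrib sum_negf flip: exp_sum)

lemma gauss_uminus: "gauss s k (\<lambda>i. - x i) = gauss s k x"
  by (simp add: gauss_def gauss1_uminus)

lemma sum_gauss_cube: "sum (gauss s k) (cube m k) = gauss_mass s m ^ k"
  unfolding gauss_def gauss_mass_def by (subst sum_prod_lattice_box) simp

lemma uminus_in_cube: "x \<in> cube m k \<Longrightarrow> (\<lambda>i. - x i) \<in> cube m k"
  by (fastforce simp: lattice_box_def)

lemma sum_cube_uminus: "(\<Sum>x\<in>cube m k. f (\<lambda>i. - x i)) = (\<Sum>x\<in>cube m k. f x)"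
  by (rule sum.reindex_bij_witness[of _ "\<lambda>x i. - x i" "\<lambda>x i. - x i"]) (auto intro: uminus_in_cube)

lemma parallelogram_sq_norm:
  "sq_norm k (\<lambda>i. x i + y i) + sq_norm k (\<lambda>i. x i - y i) = 2 * sq_norm k x + 2 * sq_norm k y"
  unfolding sq_norm_def sum.distrib[symmetric] sum_distrib_left
  by (intro sum.cong) (auto simp: power2_eq_square algebra_simps)

lemma sq_norm_nonneg: "sq_norm k x \<ge> 0"
  by (simp add: sq_norm_def sum_nonneg)

lemma gauss_mass_Suc: "gauss_mass s (Suc m) = gauss_mass s m + 2 * gauss1 s (int m + 1)"
proof -
  have "{- int (Suc m)..int (Suc m)} = insert (- (int m + 1)) (insert (int m + 1) {- int m..int m})"
    by auto
  then show ?thesis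
    by (simp add: gauss_mass_def gauss1_uminus[of s "int m + 1"] del: of_nat_Suc minus_add_distrib)
qed

text \<open>The extra summand on the left makes the induction go through: it is the unmatched half of the
  last pair \<open>2 m, 2 m + 1\<close>.\<close>

lemma sum_gauss1_doubled:
  assumes "s > 0"
  shows "(\<Sum>a = - 2 * int m..2 * int m + 1. exp (- real_of_int (min (a\<^sup>2) ((a - 1)\<^sup>2)) / (8 * s\<^sup>2)))
    + 2 * exp (- (2 * real m + 1)\<^sup>2 / (8 * s\<^sup>2)) \<le> 2 * (1 + gauss_mass s m)"
proof (induction m)
  case 0
  have "{0..1::int} = {0, 1}" by auto
  then show ?case by (simp add: gauss_mass_def gauss1_def)
next
  case (Suc m)
  let ?\<phi> = "\<lambda>a::int. exp (- real_of_int (min (a\<^sup>2) ((a - 1)\<^sup>2)) / (8 * s\<^sup>2))"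
  have set: "{- 2 * int (Suc m)..2 * int (Suc m) + 1} =
    insert (- 2 * int m - 2) (insert (- 2 * int m - 1) (insert (2 * int m + 2) (insert (2 * int m + 3)
      {- 2 * int m..2 * int m + 1})))"
    by auto
  have m: "min ((- 2 * int m - 2)\<^sup>2) ((- 2 * int m - 2 - 1)\<^sup>2) = (2 * int m + 2)\<^sup>2"
    "min ((- 2 * int m - 1)\<^sup>2) ((- 2 * int m - 1 - 1)\<^sup>2) = (2 * int m + 1)\<^sup>2"
    "min ((2 * int m + 2)\<^sup>2) ((2 * int m + 2 - 1)\<^sup>2) = (2 * int m + 1)\<^sup>2"
    "min ((2 * int m + 3)\<^sup>2) ((2 * int m + 3 - 1)\<^sup>2) = (2 * int m + 2)\<^sup>2"
    by (auto simp: min_def power2_eq_square algebra_simps)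
  have eq: "sum ?\<phi> {- 2 * int (Suc m)..2 * int (Suc m) + 1} =
      2 * exp (- (2 * real m + 2)\<^sup>2 / (8 * s\<^sup>2)) + 2 * exp (- (2 * real m + 1)\<^sup>2 / (8 * s\<^sup>2)) +
      sum ?\<phi> {- 2 * int m..2 * int m + 1}"
    unfolding set by (subst sum.insert, simp, simp)+ (simp only: m, simp)
  have g: "gauss1 s (int m + 1) = exp (- (2 * real m + 2)\<^sup>2 / (8 * s\<^sup>2))"
    using assms by (simp add: gauss1_def power2_eq_square field_simps)
  \<comment> \<open>The term for the odd number \<open>2 m + 3\<close> is dominated by that of
    \<open>2 m + 2\<close>, which is the weight of \<open>m + 1\<close>; the term for
    \<open>2 m + 1\<close> is matched by the extra summand of the induction hypothesis.\<close>
  have "exp (- (2 * real (Suc m) + 1)\<^sup>2 / (8 * s\<^sup>2)) \<le> exp (- (2 * real m + 2)\<^sup>2 / (8 * s\<^sup>2))"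
    using assms by (auto intro!: divide_right_mono power_mono)
  with Suc.IH show ?case
    unfolding eq gauss_mass_Suc g by argo
qed

lemma gauss_concentration:
  assumes s: "s > 0" and A: "A \<subseteq> cube m k"
    and far: "\<And>x y. x \<in> A \<Longrightarrow> y \<in> A \<Longrightarrow> t \<le> real_of_int (sq_norm k (\<lambda>i. x i + y i))"
  shows "sum (gauss s k) A \<le> exp (- t / (8 * s\<^sup>2)) * (1 + gauss_mass s m) ^ k"
proof -
  \<comment> \<open>Apply the inequality to \<open>A\<close> and \<open>- A\<close>; the parallelogram law turns their distance into the gain \<open>t\<close>.\<close>
  let ?T = "{- 2 * int m..2 * int m + 1}"
  \<comment> \<open>Only \<open>z = x + y + e\<close> is visible to \<open>h\<close>, with each
    entry of \<open>e\<close> being 0 or 1. The smaller of \<open>z^2\<close> and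
    \<open>(z - 1)^2\<close> is therefore a safe lower bound for \<open>(x + y)^2\<close>.\<close>
  define \<psi> where "\<psi> a = exp (- real_of_int (min (a\<^sup>2) ((a - 1)\<^sup>2)) / (8 * s\<^sup>2))" for a :: int
  define f where "f x = (if x \<in> A then gauss s k x else 0)" for x
  define h where "h z = exp (- t / (8 * s\<^sup>2)) * (\<Prod>i<k. \<psi> (z i))" for z :: "nat \<Rightarrow> int"
  have "4 ^ k * (sum f (cube m k) * sum (\<lambda>x. f (\<lambda>i. - x i)) (cube m k)) \<le> (sum h (lattice_box ?T k))\<^sup>2"
  proof (rule sum_sup_convolution_lattice_box)
    fix x y e :: "nat \<Rightarrow> int" assume e: "e \<in> lattice_box {0, 1} k"
    define z where "z = (\<lambda>i. x i + y i + e i)"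
    show "f x * f (\<lambda>i. - y i) \<le> (h (\<lambda>i. x i + y i + e i))\<^sup>2"
    proof (cases "x \<in> A \<and> (\<lambda>i. - y i) \<in> A")
      case True
      have "t \<le> real_of_int (sq_norm k (\<lambda>i. x i - y i))"
        using far[of x "\<lambda>i. - y i"] True by simp
      moreover have "(\<Sum>i<k. min ((z i)\<^sup>2) ((z i - 1)\<^sup>2)) \<le> sq_norm k (\<lambda>i. x i + y i)"
        unfolding sq_norm_def
      proof (rule sum_mono)
        fix i assume "i \<in> {..<k}"
        then have "e i = 0 \<or> e i = 1" using e by (auto simp: lattice_box_def)
        then show "min ((z i)\<^sup>2) ((z i - 1)\<^sup>2) \<le> (x i + y i)\<^sup>2" by (auto simp: z_def)
      qed
      ultimately have "t + real_of_int (\<Sum>i<k. min ((z i)\<^sup>2) ((z i - 1)\<^sup>2))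
          \<le> real_of_int (2 * sq_norm k x + 2 * sq_norm k y)"
        unfolding parallelogram_sq_norm[symmetric] by linarith
      then have "(t + real_of_int (\<Sum>i<k. min ((z i)\<^sup>2) ((z i - 1)\<^sup>2))) / (4 * s\<^sup>2)
          \<le> real_of_int (2 * sq_norm k x + 2 * sq_norm k y) / (4 * s\<^sup>2)"
        using s by (intro divide_right_mono) auto
      moreover have "f x * f (\<lambda>i. - y i) = exp (- (real_of_int (2 * sq_norm k x + 2 * sq_norm k y) / (4 * s\<^sup>2)))"
        using True by (simp add: f_def gauss_uminus gauss_eq_exp mult_exp_exp add_divide_distrib)
      moreover have "h z = exp (- ((t + real_of_int (\<Sum>i<k. min ((z i)\<^sup>2) ((z i - 1)\<^sup>2))) / (8 * s\<^sup>2)))"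
        unfolding h_def \<psi>_def exp_sum[symmetric, OF finite_lessThan] mult_exp_exp
        by (simp add: add_divide_distrib sum_negf flip: sum_divide_distrib)
      then have "(h z)\<^sup>2 = exp (- ((t + real_of_int (\<Sum>i<k. min ((z i)\<^sup>2) ((z i - 1)\<^sup>2))) / (4 * s\<^sup>2)))"
        by (simp add: power2_eq_square mult_exp_exp)
      ultimately show ?thesis unfolding z_def[symmetric] by (simp only: exp_le_cancel_iff neg_le_iff_le)
    qed (auto simp: f_def)
  next
    show "0 \<le> h x" for x by (simp add: h_def \<psi>_def prod_nonneg)
  qed (auto simp: f_def less_imp_le[OF gauss_pos])
  moreover have "sum f (cube m k) = sum (gauss s k) A"
  proof -
    have "cube m k \<inter> A = A" using A by auto
    then show ?thesis unfolding f_def by (simp add: sum.If_cases)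
  qed
  moreover have "sum h (lattice_box ?T k) = exp (- t / (8 * s\<^sup>2)) * (sum \<psi> ?T) ^ k"
    unfolding h_def sum_distrib_left[symmetric] sum_prod_lattice_box[of "\<lambda>_. \<psi>"] by simp
  ultimately have "(2 ^ k * sum (gauss s k) A)\<^sup>2 \<le> (exp (- t / (8 * s\<^sup>2)) * (sum \<psi> ?T) ^ k)\<^sup>2"
    unfolding sum_cube_uminus
  proof -
    assume le: "4 ^ k * (sum f (cube m k) * sum f (cube m k)) \<le> (sum h (lattice_box ?T k))\<^sup>2"
      and eqs: "sum f (cube m k) = sum (gauss s k) A"
        "sum h (lattice_box ?T k) = exp (- t / (8 * s\<^sup>2)) * (sum \<psi> ?T) ^ k"
    have "((2::real) ^ k)\<^sup>2 = 4 ^ k" by (simp add: power2_eq_square flip: power_mult_distrib)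
    then have "(2 ^ k * sum (gauss s k) A)\<^sup>2 = 4 ^ k * (sum (gauss s k) A * sum (gauss s k) A)"
      by (simp only: power_mult_distrib) (simp add: power2_eq_square)
    with le show ?thesis unfolding eqs by (simp only:)
  qed
  moreover have \<psi>: "sum \<psi> ?T \<ge> 0" by (simp add: \<psi>_def sum_nonneg)
  ultimately have "2 ^ k * sum (gauss s k) A \<le> exp (- t / (8 * s\<^sup>2)) * (sum \<psi> ?T) ^ k"
    by (auto elim!: power2_le_imp_le)
  also have "sum \<psi> ?T \<le> 2 * (1 + gauss_mass s m)"
    using sum_gauss1_doubled[OF s, of m] unfolding \<psi>_def by (smt (verit) exp_gt_zero)
  then have "exp (- t / (8 * s\<^sup>2)) * (sum \<psi> ?T) ^ k \<le> exp (- t / (8 * s\<^sup>2)) * (2 * (1 + gauss_mass s m)) ^ k"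
    using \<psi> by (intro mult_left_mono power_mono) auto
  finally show ?thesis unfolding power_mult_distrib by simp
qed

section \<open>Size of the one-dimensional mass\<close>

lemma gauss_mass_ge:
  assumes "0 < k" "k \<le> m"
  shows "real k \<le> gauss_mass (real k) m"
proof -
  have half: "(1 :: real) / 2 \<le> exp (- 1 / 2)"
    using exp_ge_add_one_self[of "- 1 / 2 :: real"] by simp
  \<comment> \<open>The standard deviation is \<open>k\<close>, and each of the
    \<open>2 k + 1\<close> integers within it has weight at least \<open>exp (- 1 / 2)\<close>,
    hence at least 1/2.\<close>
  have "real k \<le> (\<Sum>a = - int k..int k. 1 / 2 :: real)" by simp
  also have "\<dots> \<le> (\<Sum>a = - int k..int k. gauss1 (real k) a)"
  proof (rule sum_mono)
    fix a assume "a \<in> {- int k..int k}"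
    then have "a\<^sup>2 \<le> (int k)\<^sup>2" by (intro power2_le_iff_abs_le[THEN iffD2]) auto
    then have "(real_of_int a)\<^sup>2 \<le> (real k)\<^sup>2"
      by (metis of_int_le_iff of_int_of_nat_eq of_int_power)
    then have "exp (- 1 / 2) \<le> gauss1 (real k) a"
      using assms by (simp add: gauss1_def divide_simps)
    with half show "1 / 2 \<le> gauss1 (real k) a" by linarith
  qed
  also have "\<dots> \<le> gauss_mass (real k) m"
    unfolding gauss_mass_def using assms by (intro sum_mono2) (auto simp: less_imp_le[OF gauss1_pos])
  finally show ?thesis .
qed

lemma gauss_mass_add_le:
  "gauss_mass s (m + l) \<le> gauss_mass s m + 2 * real l * gauss1 s (int m)"
proof (induction l)
  case (Suc l)
  have "gauss1 s (int (m + l) + 1) \<le> gauss1 s (int m)"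
    unfolding gauss1_def by (auto intro!: divide_right_mono power_mono)
  then show ?case using Suc by (simp add: gauss_mass_Suc algebra_simps)
qed simp

text \<open>Translated slabs leave the cube by at most \<open>k\<close> in each coordinate. The tail
  weight there is at most \<open>exp (- k^2 / 2)\<close>, so the enlargement costs no more than the
  additive 1 already present in \<open>gauss_concentration\<close>.\<close>

lemma gauss_mass_enlarge_le:
  assumes "4 \<le> k"
  shows "gauss_mass (real k) (k\<^sup>2 + k) \<le> 1 + gauss_mass (real k) (k\<^sup>2)"
proof -
  have "2 * real k \<le> 1 + (real k)\<^sup>2 / 2"
  proof -
    have "4 * real k \<le> real k * real k" using assms by (intro mult_right_mono) auto
    then show ?thesis by (simp add: power2_eq_square)
  qed
  also have "\<dots> \<le> exp ((real k)\<^sup>2 / 2)" by (rule exp_ge_add_one_self)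
  finally have "2 * real k * exp (- ((real k)\<^sup>2 / 2)) \<le> 1"
    by (simp add: exp_minus field_simps)
  moreover have "gauss1 (real k) (int (k\<^sup>2)) = exp (- ((real k)\<^sup>2 / 2))"
    using assms by (simp add: gauss1_def power2_eq_square)
  ultimately show ?thesis using gauss_mass_add_le[of "real k" "k\<^sup>2" k] by simp
qed

text \<open>An additive error 1 per coordinate costs only a constant factor over all
  \<open>k\<close> coordinates once the one-dimensional mass is at least \<open>k\<close>. This is
  the reason for a standard deviation as large as the dimension.\<close>

lemma one_plus_power_le_exp:
  fixes z :: real
  assumes "0 < k" "real k \<le> z"
  shows "(1 + z) ^ k \<le> exp 1 * z ^ k"
proof -
  have z: "z > 0" using assms by linarith
  have "(1 + z) ^ k = (1 + 1 / z) ^ k * z ^ k"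
    using z by (simp add: field_simps flip: power_mult_distrib)
  also have "(1 + 1 / z) ^ k \<le> exp (1 / z) ^ k"
    using z exp_ge_add_one_self[of "1 / z"] by (intro power_mono) auto
  also have "\<dots> = exp (real k / z)" by (simp flip: exp_of_nat_mult)
  also have "\<dots> \<le> exp 1" using z assms by simp
  finally show ?thesis using z by simp
qed

section \<open>Anticoncentration on slabs\<close>

lemma dot_uminus: "dot k (\<lambda>i. - x i) y = - dot k x y"
  by (simp add: dot_def sum_negf)

text \<open>By the parallelogram law the weights at \<open>x + v\<close> and \<open>x - v\<close>
  have product at least \<open>exp (- 1)\<close> times the squared weight at \<open>x\<close>; then
  the arithmetic mean dominates the geometric mean.\<close>

lemma gauss_le_average_shifts:
  assumes s: "s > 0" and v: "real_of_int (sq_norm k v) \<le> s\<^sup>2"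
  shows "gauss s k x \<le> exp (1 / 2) * ((gauss s k (\<lambda>i. x i + v i) + gauss s k (\<lambda>i. x i - v i)) / 2)"
proof -
  let ?p = "gauss s k (\<lambda>i. x i + v i)" and ?m = "gauss s k (\<lambda>i. x i - v i)"
  have "?p * ?m = exp (- real_of_int (sq_norm k (\<lambda>i. x i + v i) + sq_norm k (\<lambda>i. x i - v i)) / (2 * s\<^sup>2))"
    by (simp add: gauss_eq_exp mult_exp_exp add_divide_distrib diff_divide_distrib)
  also have "\<dots> = exp (- (real_of_int (sq_norm k x) / s\<^sup>2) - real_of_int (sq_norm k v) / s\<^sup>2)"
    unfolding parallelogram_sq_norm using s by (simp add: diff_divide_distrib)
  also have "\<dots> \<ge> exp (- (real_of_int (sq_norm k x) / s\<^sup>2) - 1)"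
    using s v by simp
  finally have "exp (- (real_of_int (sq_norm k x) / s\<^sup>2) - 1) \<le> ?p * ?m" .
  moreover have "(gauss s k x * exp (- (1 / 2)))\<^sup>2 = exp (- (real_of_int (sq_norm k x) / s\<^sup>2) - 1)"
    by (simp add: gauss_eq_exp power2_eq_square mult_exp_exp)
  moreover have "?p * ?m \<le> ((?p + ?m) / 2)\<^sup>2"
    using zero_le_power2[of "?p - ?m"] by (simp add: power2_eq_square field_simps)
  ultimately have "(gauss s k x * exp (- (1 / 2)))\<^sup>2 \<le> ((?p + ?m) / 2)\<^sup>2" by linarith
  then have "gauss s k x * exp (- (1 / 2)) \<le> (?p + ?m) / 2"
    using gauss_pos[of s k "\<lambda>i. x i + v i"] gauss_pos[of s k "\<lambda>i. x i - v i"]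
    by (elim power2_le_imp_le) auto
  then show ?thesis by (simp add: exp_minus field_simps)
qed

text \<open>The slab is invariant under negation, which exchanges the shifts by \<open>v\<close> and
  \<open>- v\<close>. Their average over the slab is thus a single shifted sum.\<close>

lemma gauss_slab_le_shifted:
  fixes m :: nat and a :: real and y :: "nat \<Rightarrow> int"
  assumes s: "s > 0" and v: "real_of_int (sq_norm k v) \<le> s\<^sup>2"
  defines "E \<equiv> {x \<in> cube m k. \<bar>real_of_int (dot k x y)\<bar> \<le> a}"
  shows "sum (gauss s k) E \<le> exp (1 / 2) * (\<Sum>x\<in>E. gauss s k (\<lambda>i. x i + v i))"
proof -
  have "(\<Sum>x\<in>E. gauss s k (\<lambda>i. x i - v i)) = (\<Sum>x\<in>E. gauss s k (\<lambda>i. x i + v i))"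
  proof (rule sum.reindex_bij_witness[of _ "\<lambda>x i. - x i" "\<lambda>x i. - x i"])
    show "gauss s k (\<lambda>i. - x i + v i) = gauss s k (\<lambda>i. x i - v i)" for x
      using gauss_uminus[of s k "\<lambda>i. x i - v i"] by (simp add: algebra_simps)
  qed (auto simp: E_def dot_uminus intro: uminus_in_cube)
  moreover have "sum (gauss s k) E \<le>
      (\<Sum>x\<in>E. exp (1 / 2) * ((gauss s k (\<lambda>i. x i + v i) + gauss s k (\<lambda>i. x i - v i)) / 2))"
    by (intro sum_mono gauss_le_average_shifts s v)
  ultimately show ?thesis
    by (simp add: sum.distrib flip: sum_distrib_left sum_divide_distrib)
qed

text \<open>Consecutive translates by \<open>u\<close> change the inner product with
  \<open>y\<close> by more than the width \<open>2 a\<close> of the slab, so the \<open>J\<close>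
  translates are disjoint. Each keeps at least \<open>exp (- 1 / 2)\<close> of the mass of the slab,
  and all fit into the cube of half-side \<open>m'\<close>.\<close>

lemma gauss_slab_anticoncentration:
  assumes s: "s > 0" and u0: "\<And>i. i \<ge> k \<Longrightarrow> u i = 0" and uh: "\<And>i. \<bar>u i\<bar> \<le> int h"
    and u: "real_of_int (int J ^ 2 * sq_norm k u) \<le> s\<^sup>2"
    and D: "real_of_int (dot k u y) > 2 * a" and a: "a \<ge> 0" and m': "m + J * h \<le> m'"
  shows "real J * sum (gauss s k) {x \<in> cube m k. \<bar>real_of_int (dot k x y)\<bar> \<le> a}
    \<le> exp (1 / 2) * gauss_mass s m' ^ k"
proof -
  let ?E = "{x \<in> cube m k. \<bar>real_of_int (dot k x y)\<bar> \<le> a}"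
  define sh where "sh j x = (\<lambda>i. x i + int j * u i)" for j :: nat and x :: "nat \<Rightarrow> int"
  have inj: "inj_on (sh j) ?E" for j
    by (auto simp: sh_def fun_eq_iff intro!: inj_onI)
  have dot_sh: "dot k (sh j x) y = dot k x y + int j * dot k u y" for j x
    by (simp add: dot_def sh_def algebra_simps sum.distrib sum_distrib_left)
  have disj: "sh i ` ?E \<inter> sh j ` ?E = {}" if "i < j" for i j
  proof (rule ccontr)
    assume "sh i ` ?E \<inter> sh j ` ?E \<noteq> {}"
    then obtain x x' where x: "x \<in> ?E" "x' \<in> ?E" "sh i x = sh j x'" by blast
    then have "dot k x y - dot k x' y = (int j - int i) * dot k u y"
      using dot_sh[of i x] dot_sh[of j x'] by (simp add: algebra_simps)
    moreover have "(int j - int i) * dot k u y \<ge> 1 * dot k u y"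
      using that D a by (intro mult_right_mono) linarith+
    ultimately have "dot k x y - dot k x' y \<ge> dot k u y" by linarith
    then have "real_of_int (dot k x y) - real_of_int (dot k x' y) \<ge> real_of_int (dot k u y)"
      by (simp flip: of_int_diff)
    with x D show False by auto
  qed
  have sub: "sh j ` ?E \<subseteq> cube m' k" if "j < J" for j
  proof clarify
    fix x assume x: "x \<in> cube m k"
    have "\<bar>x i + int j * u i\<bar> \<le> int m'" if "i < k" for i
    proof -
      have "\<bar>int j * u i\<bar> \<le> int J * int h"
        using uh[of i] \<open>j < J\<close> unfolding abs_mult by (intro mult_mono) auto
      moreover have "\<bar>x i\<bar> \<le> int m" using x that by (fastforce simp: lattice_box_def)
      moreover have "int m + int J * int h \<le> int m'" using m' by (metis of_nat_add of_nat_le_iff of_nat_mult)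
      ultimately show ?thesis by linarith
    qed
    then show "sh j x \<in> cube m' k"
      using x u0 by (fastforce simp: sh_def lattice_box_def abs_le_iff)
  qed
  have "real J * sum (gauss s k) ?E = (\<Sum>j<J. sum (gauss s k) ?E)" by simp
  also have "\<dots> \<le> (\<Sum>j<J. exp (1 / 2) * (\<Sum>x\<in>sh j ` ?E. gauss s k x))"
  proof (rule sum_mono)
    fix j assume "j \<in> {..<J}"
    then have "(int j)\<^sup>2 * sq_norm k u \<le> (int J)\<^sup>2 * sq_norm k u"
      by (intro mult_right_mono power_mono) (auto simp: sq_norm_nonneg)
    moreover have "sq_norm k (\<lambda>i. int j * u i) = (int j)\<^sup>2 * sq_norm k u"
      by (simp add: sq_norm_def power_mult_distrib sum_distrib_left)
    ultimately have "real_of_int (sq_norm k (\<lambda>i. int j * u i)) \<le> s\<^sup>2"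
      using u by (metis of_int_le_iff order_trans)
    from gauss_slab_le_shifted[OF s this, of m y a]
    show "sum (gauss s k) ?E \<le> exp (1 / 2) * (\<Sum>x\<in>sh j ` ?E. gauss s k x)"
      unfolding sum.reindex[OF inj] comp_def sh_def .
  qed
  also have "\<dots> = exp (1 / 2) * sum (gauss s k) (\<Union>j<J. sh j ` ?E)"
    unfolding sum_distrib_left[symmetric]
    by (subst sum.UNION_disjoint) (use disj in \<open>auto simp: neq_iff\<close>)
  also have "\<dots> \<le> exp (1 / 2) * sum (gauss s k) (cube m' k)"
    using sub by (intro mult_left_mono sum_mono2) (auto simp: less_imp_le[OF gauss_pos])
  finally show ?thesis unfolding sum_gauss_cube .
qed

section \<open>Mass of the points with small l1 norm\<close>

lemma sum_gauss1_small_le: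
  assumes "r \<ge> 0"
  shows "(\<Sum>a\<in>{a \<in> {- int m..int m}. \<bar>real_of_int a\<bar> \<le> r}. gauss1 s a) \<le> 2 * r + 1"
proof -
  let ?A = "{a \<in> {- int m..int m}. \<bar>real_of_int a\<bar> \<le> r}"
  have "(\<Sum>a\<in>?A. gauss1 s a) \<le> (\<Sum>a\<in>?A. 1)" by (intro sum_mono gauss1_le_1)
  also have "\<dots> = real (card ?A)" by simp
  also have "card ?A \<le> card {- \<lfloor>r\<rfloor>..\<lfloor>r\<rfloor>}"
    by (intro card_mono) (auto simp: le_floor_iff abs_le_iff minus_le_iff)
  then have "real (card ?A) \<le> real (card {- \<lfloor>r\<rfloor>..\<lfloor>r\<rfloor>})" by simp
  also have "\<dots> = 2 * real_of_int \<lfloor>r\<rfloor> + 1" using assms by simp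
  also have "\<dots> \<le> 2 * r + 1" by simp
  finally show ?thesis .
qed

lemma sum_gauss_coordinate_small_le:
  assumes "r \<ge> 0" "i < k"
  shows "sum (gauss s k) {x \<in> cube m k. \<bar>real_of_int (x i)\<bar> \<le> r} \<le> (2 * r + 1) * gauss_mass s m ^ (k - 1)"
proof -
  \<comment> \<open>The condition on coordinate \<open>i\<close> is built into the factor with index
    \<open>i\<close>, so the restricted sum still factorises.\<close>
  define g where "g j a = (if j = i \<longrightarrow> \<bar>real_of_int a\<bar> \<le> r then gauss1 s a else 0)" for j a
  have g: "(\<Prod>j<k. g j (x j)) = (if \<bar>real_of_int (x i)\<bar> \<le> r then gauss s k x else 0)" for x
    unfolding gauss_def
    using assms(2) by (auto simp: g_def intro!: prod.cong bexI[of _ i])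
  have "sum (gauss s k) {x \<in> cube m k. \<bar>real_of_int (x i)\<bar> \<le> r} = (\<Sum>x\<in>cube m k. \<Prod>j<k. g j (x j))"
    unfolding g by (simp add: sum.If_cases Int_def)
  also have "\<dots> = (\<Prod>j<k. sum (g j) {- int m..int m})" by (rule sum_prod_lattice_box)
  also have "\<dots> = sum (g i) {- int m..int m} * (\<Prod>j\<in>{..<k} - {i}. sum (g j) {- int m..int m})"
    using assms(2) by (subst prod.remove[of _ i]) auto
  also have "(\<Prod>j\<in>{..<k} - {i}. sum (g j) {- int m..int m}) = (\<Prod>j\<in>{..<k} - {i}. gauss_mass s m)"
    by (intro prod.cong) (auto simp: g_def gauss_mass_def)
  also have "\<dots> = gauss_mass s m ^ (k - 1)" using assms(2) by simp
  also have "sum (g i) {- int m..int m} = (\<Sum>a\<in>{a \<in> {- int m..int m}. \<bar>real_of_int a\<bar> \<le> r}. gauss1 s a)"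
    unfolding g_def by (simp add: sum.If_cases Int_def)
  also have "\<dots> * gauss_mass s m ^ (k - 1) \<le> (2 * r + 1) * gauss_mass s m ^ (k - 1)"
    using assms(1) by (intro mult_right_mono sum_gauss1_small_le)
      (auto simp: gauss_mass_def intro!: sum_nonneg zero_le_power less_imp_le[OF gauss1_pos])
  finally show ?thesis .
qed

text \<open>Double counting: an l1 norm below \<open>r k / 2\<close> forces at least half of the
  coordinates to be at most \<open>r\<close> in absolute value, while each single coordinate is that
  small only on a set of controlled mass.\<close>

lemma sum_gauss_l1_small_le:
  assumes r: "r > 0" and k: "k > 0"
  shows "sum (gauss s k) {x \<in> cube m k. real_of_int (\<Sum>i<k. \<bar>x i\<bar>) < r * real k / 2}
    \<le> 2 * (2 * r + 1) * gauss_mass s m ^ (k - 1)"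
proof -
  let ?B = "{x \<in> cube m k. real_of_int (\<Sum>i<k. \<bar>x i\<bar>) < r * real k / 2}"
  let ?c = "\<lambda>x. real (card {i \<in> {..<k}. \<bar>real_of_int (x i)\<bar> \<le> r})"
  have half: "real k / 2 \<le> ?c x" if "x \<in> ?B" for x
  proof -
    have "r * real (card {i \<in> {..<k}. \<not> \<bar>real_of_int (x i)\<bar> \<le> r})
        = (\<Sum>i\<in>{i \<in> {..<k}. \<not> \<bar>real_of_int (x i)\<bar> \<le> r}. r)" by simp
    also have "\<dots> \<le> (\<Sum>i\<in>{i \<in> {..<k}. \<not> \<bar>real_of_int (x i)\<bar> \<le> r}. \<bar>real_of_int (x i)\<bar>)"
      by (intro sum_mono) auto
    also have "\<dots> \<le> (\<Sum>i<k. \<bar>real_of_int (x i)\<bar>)" by (intro sum_mono2) auto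
    also have "\<dots> < r * (real k / 2)" using that by simp
    finally have "real (card {i \<in> {..<k}. \<not> \<bar>real_of_int (x i)\<bar> \<le> r}) < real k / 2"
      using r by simp
    moreover have "card {i \<in> {..<k}. \<bar>real_of_int (x i)\<bar> \<le> r} + card {i \<in> {..<k}. \<not> \<bar>real_of_int (x i)\<bar> \<le> r}
        = card {..<k}"
    proof -
      have "card {..<k} = card ({i \<in> {..<k}. \<bar>real_of_int (x i)\<bar> \<le> r} \<union> {i \<in> {..<k}. \<not> \<bar>real_of_int (x i)\<bar> \<le> r})"
        by (rule arg_cong) blast
      also have "\<dots> = card {i \<in> {..<k}. \<bar>real_of_int (x i)\<bar> \<le> r} + card {i \<in> {..<k}. \<not> \<bar>real_of_int (x i)\<bar> \<le> r}"
        by (rule card_Un_disjoint) auto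
      finally show ?thesis by simp
    qed
    then have "?c x + real (card {i \<in> {..<k}. \<not> \<bar>real_of_int (x i)\<bar> \<le> r}) = real k"
      by (simp flip: of_nat_add)
    ultimately show ?thesis by linarith
  qed
  have "real k / 2 * sum (gauss s k) ?B = (\<Sum>x\<in>?B. real k / 2 * gauss s k x)"
    by (rule sum_distrib_left)
  also have "\<dots> \<le> (\<Sum>x\<in>?B. ?c x * gauss s k x)"
    by (intro sum_mono mult_right_mono half) (auto simp: less_imp_le[OF gauss_pos])
  also have "\<dots> \<le> (\<Sum>x\<in>cube m k. ?c x * gauss s k x)"
    by (intro sum_mono2) (auto simp: less_imp_le[OF gauss_pos])
  also have "\<dots> = (\<Sum>x\<in>cube m k. \<Sum>i<k. if \<bar>real_of_int (x i)\<bar> \<le> r then gauss s k x else 0)"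
    by (simp add: sum.If_cases Int_def)
  also have "\<dots> = (\<Sum>i<k. \<Sum>x\<in>cube m k. if \<bar>real_of_int (x i)\<bar> \<le> r then gauss s k x else 0)"
    by (rule sum.swap)
  also have "\<dots> = (\<Sum>i<k. sum (gauss s k) {x \<in> cube m k. \<bar>real_of_int (x i)\<bar> \<le> r})"
    by (simp add: sum.If_cases Int_def)
  also have "\<dots> \<le> (\<Sum>i<k. (2 * r + 1) * gauss_mass s m ^ (k - 1))"
    using r by (intro sum_mono sum_gauss_coordinate_small_le) auto
  finally have "real k / 2 * sum (gauss s k) ?B \<le> real k * ((2 * r + 1) * gauss_mass s m ^ (k - 1))"
    unfolding sum_constant card_lessThan .
  moreover have cancel: "w \<le> 2 * z" if "real k / 2 * w \<le> real k * z" for w z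
    using that k by (simp add: field_simps)
  ultimately have "sum (gauss s k) ?B \<le> 2 * ((2 * r + 1) * gauss_mass s m ^ (k - 1))"
    by (intro cancel)
  then show ?thesis unfolding mult.assoc .
qed

section \<open>Blow-ups of weighted templates\<close>

text \<open>The disjoint union of the prescribed classes injects into the \<open>n\<close> vertices;
  vertices outside the image get \<open>None\<close>.\<close>

lemma exists_partial_colouring:
  assumes I: "finite I" and N: "sum N I \<le> n"
  shows "\<exists>c :: nat \<Rightarrow> 'i option. (\<forall>i\<in>I. card {v \<in> {..<n}. c v = Some i} = N i) \<and>
    (\<forall>v i. c v = Some i \<longrightarrow> i \<in> I)"
proof -
  let ?S = "SIGMA i:I. {..<N i}"
  have "finite ?S" "card ?S \<le> card {..<n}" using I N by auto
  then obtain g where g: "g ` ?S \<subseteq> {..<n}" "inj_on g ?S"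
    using card_le_inj[of ?S "{..<n}"] by auto
  define c where "c v = (if v \<in> g ` ?S then Some (fst (inv_into ?S g v)) else None)" for v
  have cg: "c (g (i, j)) = Some i" if "i \<in> I" "j < N i" for i j
    using that inv_into_f_f[OF g(2), of "(i, j)"] by (auto simp: c_def)
  have "card {v \<in> {..<n}. c v = Some i} = N i" if i: "i \<in> I" for i
  proof -
    have "{v \<in> {..<n}. c v = Some i} = g ` ({i} \<times> {..<N i})"
    proof
      show "{v \<in> {..<n}. c v = Some i} \<subseteq> g ` ({i} \<times> {..<N i})"
      proof
        fix v assume v: "v \<in> {v \<in> {..<n}. c v = Some i}"
        then have "v \<in> g ` ?S" by (auto simp: c_def split: if_splits)
        then obtain i' j where ij: "i' \<in> I" "j < N i'" "v = g (i', j)" by auto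
        then show "v \<in> g ` ({i} \<times> {..<N i})" using v cg[of i' j] by auto
      qed
      show "g ` ({i} \<times> {..<N i}) \<subseteq> {v \<in> {..<n}. c v = Some i}"
        using i cg g(1)[THEN subsetD, OF imageI] by auto
    qed
    moreover have "inj_on g ({i} \<times> {..<N i})" by (rule inj_on_subset[OF g(2)]) (use i in auto)
    ultimately show ?thesis by (simp add: card_image card_cartesian_product)
  qed
  moreover have "i \<in> I" if "c v = Some i" for v i
  proof -
    from that have "v \<in> g ` ?S" by (auto simp: c_def split: if_splits)
    then obtain i' j where ij: "i' \<in> I" "j < N i'" "v = g (i', j)" by auto
    then show ?thesis using that cg[of i' j] by auto
  qed
  ultimately show ?thesis by blast
qed

text \<open>\<open>R\<close> gives the edges inside either side and \<open>S\<close> those across.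
  The two exclusion axioms treat the ways in which a clique on four vertices can meet two sides, and
  \<gamma> bounds the weight of an independent set in one side.\<close>

locale weighted_template =
  fixes P :: "'p set" and \<nu> :: "'p \<Rightarrow> real" and R S :: "'p \<Rightarrow> 'p \<Rightarrow> bool" and \<gamma> :: real
  assumes finite_P: "finite P"
    and nu_nonneg: "p \<in> P \<Longrightarrow> 0 \<le> \<nu> p"
    and nu_sum: "sum \<nu> P = 1"
    and R_sym: "R p p' \<Longrightarrow> R p' p"
    and R_irrefl: "p \<in> P \<Longrightarrow> \<not> R p p"
    and R_triangle_free: "\<lbrakk>p \<in> P; p' \<in> P; p'' \<in> P; R p p'; R p' p''; R p p''\<rbrakk> \<Longrightarrow> False"
    and no_crossing_pair: "\<lbrakk>p \<in> P; p' \<in> P; r \<in> P; r' \<in> P; R p p'; R r r'; S p r; S p r'; S p' r; S p' r'\<rbrakk> \<Longrightarrow> False"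
    and R_free_small: "\<lbrakk>A \<subseteq> P; \<And>p p'. p \<in> A \<Longrightarrow> p' \<in> A \<Longrightarrow> \<not> R p p'\<rbrakk> \<Longrightarrow> sum \<nu> A \<le> \<gamma>"
begin

text \<open>The Boolean component is the side; \<open>S\<close> is read from the \<open>False\<close> side to the \<open>True\<close> side.\<close>

definition joined :: "'p \<times> bool \<Rightarrow> 'p \<times> bool \<Rightarrow> bool" where
  "joined x y = (if snd x = snd y then R (fst x) (fst y)
     else if snd y then S (fst x) (fst y) else S (fst y) (fst x))"

lemma joined_sym: "joined x y \<Longrightarrow> joined y x"
  by (auto simp: joined_def dest: R_sym split: if_splits)

text \<open>Of four vertices on two sides, either three share a side, against
  \<open>R_triangle_free\<close>, or two lie on each side, against
  \<open>no_crossing_pair\<close>.\<close>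

lemma no_joined_K4:
  assumes P: "fst a \<in> P" "fst b \<in> P" "fst c \<in> P" "fst d \<in> P"
    and joined: "joined a b" "joined a c" "joined a d" "joined b c" "joined b d" "joined c d"
  shows False
proof -
  have triple: False
    if "fst x \<in> P" "fst y \<in> P" "fst z \<in> P" "joined x y" "joined y z" "joined x z" "snd x = snd y" "snd y = snd z"
    for x y z
    using that R_triangle_free[of "fst x" "fst y" "fst z"] by (simp add: joined_def)
  have pairs: False
    if "fst x \<in> P" "fst x' \<in> P" "fst y \<in> P" "fst y' \<in> P" "joined x x'" "joined y y'"
      "joined x y" "joined x y'" "joined x' y" "joined x' y'" "snd x = snd x'" "snd y = snd y'" "snd x \<noteq> snd y"
    for x x' y y'
    using that no_crossing_pair[of "fst x" "fst x'" "fst y" "fst y'"] no_crossing_pair[of "fst y" "fst y'" "fst x" "fst x'"]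
    by (cases "snd x") (auto simp: joined_def)
  note sym = joined[THEN joined_sym]
  consider "snd a = snd b" "snd b = snd c" | "snd a = snd b" "snd b = snd d" | "snd a = snd c" "snd c = snd d"
    | "snd b = snd c" "snd c = snd d" | "snd a = snd b" "snd c = snd d" "snd a \<noteq> snd c"
    | "snd a = snd c" "snd b = snd d" "snd a \<noteq> snd b" | "snd a = snd d" "snd b = snd c" "snd a \<noteq> snd b"
    by argo
  then show False
  proof cases
    case 1 then show ?thesis using triple[of a b c] P joined by blast
  next
    case 2 then show ?thesis using triple[of a b d] P joined by blast
  next
    case 3 then show ?thesis using triple[of a c d] P joined by blast
  next
    case 4 then show ?thesis using triple[of b c d] P joined by blast
  next
    case 5 then show ?thesis using pairs[of a b c d] P joined by blast
  next
    case 6 then show ?thesis using pairs[of a c b d] P joined sym by blast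
  next
    case 7 then show ?thesis using pairs[of a d b c] P joined sym by blast
  qed
qed

text \<open>Vertices without a colour are isolated; they absorb the rounding errors.\<close>

definition blow_up :: "(nat \<Rightarrow> ('p \<times> bool) option) \<Rightarrow> nat \<Rightarrow> nat ugraph" where
  "blow_up c n = ({..<n}, {{u, v} |u v. u < n \<and> v < n \<and>
     (\<exists>x y. c u = Some x \<and> c v = Some y \<and> joined x y)})"

lemma verts_blow_up [simp]: "verts (blow_up c n) = {..<n}"
  by (simp add: blow_up_def verts_def)

lemma in_edges_blow_up_iff:
  "{u, v} \<in> edges (blow_up c n) \<longleftrightarrow> u < n \<and> v < n \<and> (\<exists>x y. c u = Some x \<and> c v = Some y \<and> joined x y)"
proof
  assume "{u, v} \<in> edges (blow_up c n)"
  then show "u < n \<and> v < n \<and> (\<exists>x y. c u = Some x \<and> c v = Some y \<and> joined x y)"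
    by (auto simp: blow_up_def edges_def doubleton_eq_iff dest: joined_sym)
next
  assume "u < n \<and> v < n \<and> (\<exists>x y. c u = Some x \<and> c v = Some y \<and> joined x y)"
  then show "{u, v} \<in> edges (blow_up c n)"
    unfolding blow_up_def edges_def snd_conv by blast
qed

context
  fixes c :: "nat \<Rightarrow> ('p \<times> bool) option" and n :: nat
  assumes c_range: "c v = Some x \<Longrightarrow> fst x \<in> P"
    and c_fibre: "p \<in> P \<Longrightarrow> card {v \<in> {..<n}. c v = Some (p, b)} = nat \<lfloor>real n * \<nu> p / 2\<rfloor>"
begin

lemma finite_simple_graph_blow_up: "finite_simple_graph (blow_up c n)"
proof -
  have "u \<noteq> v" if "c u = Some x" "c v = Some y" "joined x y" for u v x y
    using that R_irrefl[OF c_range[OF that(1)]] by (auto simp: joined_def)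
  then show ?thesis
    by (fastforce simp: finite_simple_graph_def blow_up_def verts_def edges_def nsets_def)
qed

lemma blow_up_K4_free: "\<not> contains_copy (blow_up c n) (complete_graph 4)"
proof
  assume "contains_copy (blow_up c n) (complete_graph 4)"
  then obtain \<phi> where \<phi>: "\<forall>e\<in>[{..<4::nat}]\<^bsup>2\<^esup>. \<phi> ` e \<in> edges (blow_up c n)"
    unfolding contains_copy_def complete_graph_def edges_def snd_conv by blast
  have adj: "\<exists>x y. c (\<phi> i) = Some x \<and> c (\<phi> j) = Some y \<and> joined x y" if "i < 4" "j < 4" "i \<noteq> j" for i j :: nat
  proof -
    have "{i, j} \<in> [{..<4}]\<^bsup>2\<^esup>" using that by (auto simp: nsets_def)
    then have "{\<phi> i, \<phi> j} \<in> edges (blow_up c n)" using \<phi> by fastforce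
    then show ?thesis unfolding in_edges_blow_up_iff by blast
  qed
  define x where "x i = the (c (\<phi> i))" for i
  have x: "joined (x i) (x j)" if "i < 4" "j < 4" "i \<noteq> j" for i j :: nat
    using adj[OF that] by (auto simp: x_def)
  have P: "fst (x i) \<in> P" if i: "i < 4" for i
  proof -
    \<comment> \<open>Any second index gives an edge at \<open>\<phi> i\<close>, and only coloured
      vertices have edges.\<close>
    have "(if i = 0 then 1 else 0) < (4::nat)" "i \<noteq> (if i = 0 then 1 else 0)" by auto
    from adj[OF i this] obtain y where "c (\<phi> i) = Some y" by blast
    then show ?thesis using c_range[of "\<phi> i" y] by (simp add: x_def)
  qed
  show False
    by (rule no_joined_K4[of "x 0" "x 1" "x 2" "x 3"]) (auto intro!: x P)
qed

lemma real_fibre: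
  assumes "p \<in> P"
  shows "real (card {v \<in> {..<n}. c v = Some (p, b)}) \<le> real n * \<nu> p / 2"
    and "real n * \<nu> p / 2 - 1 \<le> real (card {v \<in> {..<n}. c v = Some (p, b)})"
proof -
  have "real n * \<nu> p / 2 \<ge> 0" using nu_nonneg[OF assms] by simp
  then show "real (card {v \<in> {..<n}. c v = Some (p, b)}) \<le> real n * \<nu> p / 2"
    "real n * \<nu> p / 2 - 1 \<le> real (card {v \<in> {..<n}. c v = Some (p, b)})"
    unfolding c_fibre[OF assms] by linarith+
qed

text \<open>Each of the \<open>2 * card P\<close> fibres loses at most one vertex to rounding, and
  without rounding the fibres would exhaust all \<open>n\<close> vertices.\<close>

lemma uncoloured_le: "real (card {v \<in> {..<n}. c v = None}) \<le> 2 * real (card P)"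
proof -
  let ?F = "\<lambda>x. {v \<in> {..<n}. c v = Some x}"
  have split: "{..<n} = {v \<in> {..<n}. c v = None} \<union> (\<Union>x\<in>P \<times> UNIV. ?F x)"
    using c_range by (auto intro: prod.exhaust)
  have "n = card {..<n}" by simp
  also have "\<dots> = card ({v \<in> {..<n}. c v = None} \<union> (\<Union>x\<in>P \<times> UNIV. ?F x))"
    using split by (rule arg_cong)
  also have "\<dots> = card {v \<in> {..<n}. c v = None} + card (\<Union>x\<in>P \<times> UNIV. ?F x)"
    using finite_P by (intro card_Un_disjoint) auto
  also have "card (\<Union>x\<in>P \<times> UNIV. ?F x) = (\<Sum>x\<in>P \<times> UNIV. card (?F x))"
    using finite_P by (intro card_UN_disjoint) auto
  finally have total: "real n = real (card {v \<in> {..<n}. c v = None}) + (\<Sum>x\<in>P \<times> UNIV. real (card (?F x)))"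
    unfolding of_nat_add[symmetric] of_nat_sum[symmetric] by (rule arg_cong)
  have "(\<Sum>x\<in>P \<times> (UNIV :: bool set). real n * \<nu> (fst x) / 2 - 1) = (\<Sum>p\<in>P. \<Sum>b\<in>(UNIV :: bool set). real n * \<nu> p / 2 - 1)"
    unfolding sum.cartesian_product by (simp add: case_prod_beta')
  also have "\<dots> = real n * sum \<nu> P - 2 * real (card P)"
    by (simp add: UNIV_bool sum_subtractf sum.distrib sum_distrib_left flip: sum_divide_distrib)
  finally have "(\<Sum>x\<in>P \<times> (UNIV :: bool set). real n * \<nu> (fst x) / 2 - 1) = real n - 2 * real (card P)"
    unfolding nu_sum by simp
  moreover have "(\<Sum>x\<in>P \<times> (UNIV :: bool set). real n * \<nu> (fst x) / 2 - 1) \<le> (\<Sum>x\<in>P \<times> UNIV. real (card (?F x)))"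
    by (intro sum_mono) (use real_fibre(2) in \<open>auto simp del: lessThan_iff\<close>)
  ultimately show ?thesis using total by linarith
qed

text \<open>The points of \<open>P\<close> used by an independent set on one side contain no
  \<open>R\<close>-related pair, so \<open>R_free_small\<close> bounds their weight and hence the
  union of their fibres.\<close>

lemma indep_side_le:
  assumes "I \<subseteq> {..<n}" "indep I (edges (blow_up c n))"
  shows "real (card {v \<in> I. \<exists>p. c v = Some (p, b)}) \<le> real n * \<gamma> / 2"
proof -
  define A where "A = {p. \<exists>v\<in>I. c v = Some (p, b)}"
  have A: "A \<subseteq> P" using c_range by (fastforce simp: A_def)
  have free: "\<not> R p p'" if "p \<in> A" "p' \<in> A" for p p'
  proof
    assume "R p p'"
    from that obtain u v where uv: "u \<in> I" "v \<in> I" "c u = Some (p, b)" "c v = Some (p', b)"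
      by (auto simp: A_def)
    have "p \<noteq> p'" using R_irrefl A that \<open>R p p'\<close> by blast
    then have "u \<noteq> v" using uv by auto
    moreover have "{u, v} \<in> edges (blow_up c n)"
      unfolding in_edges_blow_up_iff using uv assms(1) \<open>R p p'\<close> by (auto simp: joined_def)
    ultimately show False using assms(2) uv by (auto simp: indep_def)
  qed
  have "{v \<in> I. \<exists>p. c v = Some (p, b)} \<subseteq> (\<Union>p\<in>A. {v \<in> {..<n}. c v = Some (p, b)})"
    using assms(1) by (auto simp: A_def)
  then have "card {v \<in> I. \<exists>p. c v = Some (p, b)} \<le> card (\<Union>p\<in>A. {v \<in> {..<n}. c v = Some (p, b)})"
    using finite_subset[OF A finite_P] by (intro card_mono) auto
  also have "\<dots> \<le> (\<Sum>p\<in>A. card {v \<in> {..<n}. c v = Some (p, b)})"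
    using finite_subset[OF A finite_P] by (rule card_UN_le)
  finally have "real (card {v \<in> I. \<exists>p. c v = Some (p, b)}) \<le> (\<Sum>p\<in>A. real (card {v \<in> {..<n}. c v = Some (p, b)}))"
    unfolding of_nat_sum[symmetric] of_nat_le_iff .
  also have "\<dots> \<le> (\<Sum>p\<in>A. real n * \<nu> p / 2)"
    using A by (intro sum_mono real_fibre(1)) auto
  also have "\<dots> = real n * sum \<nu> A / 2" by (simp add: sum_distrib_left sum_divide_distrib)
  also have "\<dots> \<le> real n * \<gamma> / 2"
    using R_free_small[OF A free] by (intro divide_right_mono mult_left_mono) auto
  finally show ?thesis .
qed

lemma independence_number_blow_up_le:
  "real (independence_number (blow_up c n)) \<le> real n * \<gamma> + 2 * real (card P)"
proof -
  let ?C = "{card I |I. I \<subseteq> verts (blow_up c n) \<and> indep I (edges (blow_up c n))}"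
  have "?C \<subseteq> {..n}" using card_mono[of "{..<n}"] by fastforce
  moreover have "0 \<in> ?C" by (auto intro!: exI[of _ "{}"] simp: indep_def)
  ultimately have "independence_number (blow_up c n) \<in> ?C"
    unfolding independence_number_def by (intro Max_in) (auto intro: finite_subset)
  then obtain I where I: "I \<subseteq> {..<n}" "indep I (edges (blow_up c n))"
    and eq: "independence_number (blow_up c n) = card I" by auto
  let ?s = "\<lambda>b. {v \<in> I. \<exists>p. c v = Some (p, b)}"
  have "I \<subseteq> {v \<in> {..<n}. c v = None} \<union> (?s False \<union> ?s True)"
  proof
    fix v assume "v \<in> I"
    then show "v \<in> {v \<in> {..<n}. c v = None} \<union> (?s False \<union> ?s True)"
    proof (cases "c v")
      case (Some x)
      with \<open>v \<in> I\<close> show ?thesis by (cases x; cases "snd x") auto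
    qed (use \<open>v \<in> I\<close> I(1) in auto)
  qed
  moreover have "finite I" using I(1) finite_subset by blast
  ultimately have "card I \<le> card ({v \<in> {..<n}. c v = None} \<union> (?s False \<union> ?s True))"
    by (intro card_mono) auto
  also have "\<dots> \<le> card {v \<in> {..<n}. c v = None} + card (?s False \<union> ?s True)" by (rule card_Un_le)
  also have "\<dots> \<le> card {v \<in> {..<n}. c v = None} + (card (?s False) + card (?s True))"
    by (intro add_left_mono card_Un_le)
  finally have "real (card I) \<le> real (card {v \<in> {..<n}. c v = None}) + (real (card (?s False)) + real (card (?s True)))"
    by linarith
  then show ?thesis
    unfolding eq using uncoloured_le indep_side_le[OF I, of False] indep_side_le[OF I, of True] by linarith
qed

text \<open>Counting only edges across suffices: each \<open>S\<close>-pair contributes the product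
  of two fibre sizes. The rounding losses, summed over all of \<open>P \<times> P\<close>, amount to
  \<open>n * card P\<close>.\<close>

lemma card_edges_blow_up_ge:
  "real (card (edges (blow_up c n))) \<ge>
    (real n)\<^sup>2 / 4 * (\<Sum>(p, r)\<in>{(p, r) \<in> P \<times> P. S p r}. \<nu> p * \<nu> r) - real n * real (card P)"
proof -
  let ?F = "\<lambda>b p. {v \<in> {..<n}. c v = Some (p, b)}"
  let ?Q = "{(p, r) \<in> P \<times> P. S p r}"
  let ?X = "\<Union>(p, r)\<in>?Q. ?F False p \<times> ?F True r"
  have finQ: "finite ?Q" using finite_P by (auto intro: finite_subset[of _ "P \<times> P"])
  have fin: "finite (edges (blow_up c n))"
    using finite_simple_graph_blow_up finite_imp_finite_nsets[of "{..<n}" 2]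
    by (auto simp: finite_simple_graph_def intro: finite_subset)
  have sub: "(\<lambda>(u, v). {u, v}) ` ?X \<subseteq> edges (blow_up c n)"
    by (auto simp: in_edges_blow_up_iff joined_def)
  have "inj_on (\<lambda>(u, v). {u, v}) ?X"
    by (auto simp: inj_on_def doubleton_eq_iff)
  then have "card ?X = card ((\<lambda>(u, v). {u, v}) ` ?X)" by (rule card_image[symmetric])
  also have "\<dots> \<le> card (edges (blow_up c n))" by (rule card_mono[OF fin sub])
  finally have "card ?X \<le> card (edges (blow_up c n))" .
  moreover have "card ?X = (\<Sum>(p, r)\<in>?Q. card (?F False p) * card (?F True r))"
    using finQ by (subst card_UN_disjoint) (auto simp: card_cartesian_product intro!: sum.cong)
  ultimately have "(\<Sum>(p, r)\<in>?Q. real (card (?F False p)) * real (card (?F True r))) \<le> real (card (edges (blow_up c n)))"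
    by (simp add: case_prod_beta' flip: of_nat_mult of_nat_sum)
  moreover have "(\<Sum>(p, r)\<in>?Q. (real n)\<^sup>2 / 4 * (\<nu> p * \<nu> r) - (real n * \<nu> p / 2 + real n * \<nu> r / 2))
      \<le> (\<Sum>(p, r)\<in>?Q. real (card (?F False p)) * real (card (?F True r)))"
  proof (rule sum_mono, clarify)
    fix p r assume pr: "p \<in> P" "r \<in> P"
    define \<alpha> where "\<alpha> = real n * \<nu> p / 2"
    define \<beta> where "\<beta> = real n * \<nu> r / 2"
    \<comment> \<open>For fibre sizes \<open>A\<close> and \<open>B\<close> the loss is
      \<open>\<alpha> * \<beta> - A * B = (\<alpha> - A) * \<beta> + A * (\<beta> - B)\<close>, and
      both differences are at most 1.\<close>
    have "(\<alpha> - real (card (?F False p))) * \<beta> \<le> 1 * \<beta>"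
      using real_fibre[OF pr(1), of False] nu_nonneg[OF pr(2)]
      by (intro mult_right_mono) (auto simp: \<alpha>_def \<beta>_def)
    moreover have "real (card (?F False p)) * (\<beta> - real (card (?F True r))) \<le> \<alpha> * 1"
      using real_fibre[OF pr(1), of False] real_fibre[OF pr(2), of True] nu_nonneg[OF pr(1)]
      by (intro mult_mono) (auto simp: \<alpha>_def \<beta>_def)
    ultimately have "\<alpha> * \<beta> - (\<alpha> + \<beta>) \<le> real (card (?F False p)) * real (card (?F True r))"
      by (simp add: algebra_simps)
    then show "(real n)\<^sup>2 / 4 * (\<nu> p * \<nu> r) - (real n * \<nu> p / 2 + real n * \<nu> r / 2)
      \<le> real (card (?F False p)) * real (card (?F True r))"
      by (simp add: \<alpha>_def \<beta>_def power2_eq_square algebra_simps)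
  qed
  moreover have "(\<Sum>(p, r)\<in>?Q. real n * \<nu> p / 2 + real n * \<nu> r / 2)
      \<le> (\<Sum>(p, r)\<in>P \<times> P. real n * \<nu> p / 2 + real n * \<nu> r / 2)"
    using finite_P by (intro sum_mono2) (auto simp: nu_nonneg)
  moreover have "(\<Sum>(p, r)\<in>P \<times> P. real n * \<nu> p / 2 + real n * \<nu> r / 2) = real n * real (card P)"
  proof -
    have half: "(\<Sum>p\<in>P. real n * \<nu> p / 2) = real n / 2"
      using nu_sum by (simp flip: sum_divide_distrib sum_distrib_left)
    have "(\<Sum>(p, r)\<in>P \<times> P. real n * \<nu> p / 2 + real n * \<nu> r / 2)
        = (\<Sum>p\<in>P. real (card P) * (real n * \<nu> p / 2) + real n / 2)"
      unfolding sum.cartesian_product[symmetric] sum.distrib sum_constant half ..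
    also have "\<dots> = real n * real (card P)"
      unfolding sum.distrib sum_distrib_left[symmetric] half by simp
    finally show ?thesis .
  qed
  moreover have "(\<Sum>(p, r)\<in>?Q. (real n)\<^sup>2 / 4 * (\<nu> p * \<nu> r) - (real n * \<nu> p / 2 + real n * \<nu> r / 2)) =
      (real n)\<^sup>2 / 4 * (\<Sum>(p, r)\<in>?Q. \<nu> p * \<nu> r) - (\<Sum>(p, r)\<in>?Q. real n * \<nu> p / 2 + real n * \<nu> r / 2)"
    unfolding case_prod_beta' sum_subtractf sum_distrib_left ..
  ultimately show ?thesis by linarith
qed

end

lemma exists_blow_up:
  "\<exists>G :: nat ugraph. finite_simple_graph G \<and> card (verts G) = n \<and> \<not> contains_copy G (complete_graph 4) \<and>
     real (independence_number G) \<le> real n * \<gamma> + 2 * real (card P) \<and>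
     real (card (edges G)) \<ge>
       (real n)\<^sup>2 / 4 * (\<Sum>(p, r)\<in>{(p, r) \<in> P \<times> P. S p r}. \<nu> p * \<nu> r) - real n * real (card P)"
proof -
  let ?N = "\<lambda>x :: 'p \<times> bool. nat \<lfloor>real n * \<nu> (fst x) / 2\<rfloor>"
  have "real (\<Sum>x\<in>P \<times> UNIV. ?N x) \<le> (\<Sum>x\<in>P \<times> (UNIV :: bool set). real n * \<nu> (fst x) / 2)"
    unfolding of_nat_sum
  proof (rule sum_mono)
    fix x :: "'p \<times> bool" assume "x \<in> P \<times> UNIV"
    then have "real n * \<nu> (fst x) / 2 \<ge> 0" using nu_nonneg by auto
    then show "real (?N x) \<le> real n * \<nu> (fst x) / 2" by linarith
  qed
  also have "\<dots> = (\<Sum>p\<in>P. \<Sum>b\<in>(UNIV :: bool set). real n * \<nu> p / 2)"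
    unfolding sum.cartesian_product by (simp add: case_prod_beta')
  also have "\<dots> = real n * sum \<nu> P" by (simp add: UNIV_bool sum_distrib_left)
  finally have "(\<Sum>x\<in>P \<times> UNIV. ?N x) \<le> n" unfolding nu_sum by linarith
  then obtain c where c: "\<forall>x\<in>P \<times> UNIV. card {v \<in> {..<n}. c v = Some x} = ?N x" "\<forall>v x. c v = Some x \<longrightarrow> x \<in> P \<times> UNIV"
    using exists_partial_colouring[of "P \<times> UNIV" ?N n] finite_P by auto
  have range: "\<And>v x. c v = Some x \<Longrightarrow> fst x \<in> P"
    and fibre: "\<And>p b. p \<in> P \<Longrightarrow> card {v \<in> {..<n}. c v = Some (p, b)} = nat \<lfloor>real n * \<nu> p / 2\<rfloor>"
    using c by force+
  show ?thesis
  proof (intro exI[of _ "blow_up c n"] conjI)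
    show "finite_simple_graph (blow_up c n)"
      by (rule finite_simple_graph_blow_up[OF range fibre])
    show "\<not> contains_copy (blow_up c n) (complete_graph 4)"
      by (rule blow_up_K4_free[OF range fibre])
    show "real (independence_number (blow_up c n)) \<le> real n * \<gamma> + 2 * real (card P)"
      by (rule independence_number_blow_up_le[OF range fibre])
    show "(real n)\<^sup>2 / 4 * (\<Sum>(p, r)\<in>{(p, r) \<in> P \<times> P. S p r}. \<nu> p * \<nu> r) - real n * real (card P)
        \<le> real (card (edges (blow_up c n)))"
      by (rule card_edges_blow_up_ge[OF range fibre])
  qed simp
qed

end

section \<open>The Gaussian template\<close>

lemma dot_add_add:
  "dot k (\<lambda>i. x i + x' i) (\<lambda>i. y i + y' i) = dot k x y + dot k x y' + dot k x' y + dot k x' y'"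
  unfolding dot_def sum.distrib[symmetric] by (intro sum.cong) (auto simp: algebra_simps)

lemma two_dot_le: "2 * dot k x y \<le> sq_norm k x + sq_norm k y"
  unfolding dot_def sq_norm_def sum.distrib[symmetric] sum_distrib_left
proof (rule sum_mono)
  fix i
  show "2 * (x i * y i) \<le> (x i)\<^sup>2 + (y i)\<^sup>2"
    using zero_le_power2[of "x i - y i"] by (simp add: power2_eq_square algebra_simps)
qed

text \<open>Cauchy-Schwarz for \<open>2 x = (x + y) - (y + z) + (x + z)\<close>. It excludes
  triangles of nearly antipodal points of large norm.\<close>

lemma four_sq_norm_le:
  "4 * sq_norm k x \<le> 3 * (sq_norm k (\<lambda>i. x i + y i) + sq_norm k (\<lambda>i. y i + z i) + sq_norm k (\<lambda>i. x i + z i))"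
  unfolding sq_norm_def sum.distrib[symmetric] sum_distrib_left
proof (rule sum_mono)
  fix i
  have "(a - b + c)\<^sup>2 \<le> 3 * (a\<^sup>2 + b\<^sup>2 + c\<^sup>2)" for a b c :: int
    using zero_le_power2[of "a + b"] zero_le_power2[of "b + c"] zero_le_power2[of "a - c"]
    by (simp add: power2_eq_square algebra_simps)
  from this[of "x i + y i" "y i + z i" "x i + z i"]
  show "4 * (x i)\<^sup>2 \<le> 3 * ((x i + y i)\<^sup>2 + (y i + z i)\<^sup>2 + (x i + z i)\<^sup>2)"
    by (simp add: power_mult_distrib)
qed

text \<open>\<open>J\<close> controls the density error, which is of order \<open>1 / J\<close>, and
  \<open>q / J\<close> controls the decay of the independence ratio. In the end \<open>J\<close>
  stays fixed while \<open>q\<close> grows with \<open>n\<close>.\<close>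

locale gaussian_parameters =
  fixes J q :: nat
  assumes J: "12 \<le> J" and q: "5 \<le> q"
begin

text \<open>The dimension is the square \<open>(J q)\<^sup>2\<close>, so that all of the \<open>J\<close> translations by multiples of a
  vector with entries \<open>\<plusminus> q\<close> have length at most the standard deviation, which is also \<open>k\<close>.\<close>

definition k :: nat where "k = (J * q)\<^sup>2"

text \<open>This is \<open>q\<close> times the l1 norm required of a point outside
  \<open>flat\<close>, so a shift by a sign vector with entries of size \<open>q\<close> changes the
  inner product by at least \<open>t\<close>. The concentration exponent \<open>t / (8 k^2)\<close>
  becomes \<open>q / (16 J)\<close>.\<close>

definition t :: real where "t = real q * (real k)\<^sup>2 / (2 * real J)"

definition w :: "(nat \<Rightarrow> int) \<Rightarrow> real" where "w = gauss (real k) k"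

definition C :: "(nat \<Rightarrow> int) set" where "C = cube (k\<^sup>2) k"

definition Z :: real where "Z = gauss_mass (real k) (k\<^sup>2)"

definition P :: "(nat \<Rightarrow> int) set" where "P = {x \<in> C. 9 * t < 4 * real_of_int (sq_norm k x)}"

definition near_antipodal :: "(nat \<Rightarrow> int) \<Rightarrow> (nat \<Rightarrow> int) \<Rightarrow> bool" where
  "near_antipodal x y \<longleftrightarrow> real_of_int (sq_norm k (\<lambda>i. x i + y i)) \<le> t"

definition acute :: "(nat \<Rightarrow> int) \<Rightarrow> (nat \<Rightarrow> int) \<Rightarrow> bool" where
  "acute x y \<longleftrightarrow> t / 4 < real_of_int (dot k x y)"

section \<open>Elementary relations between the parameters\<close>

lemma Jq_le_k: "J * q \<le> k"
  unfolding k_def by (simp add: power2_nat_le_imp_le power2_eq_square)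

lemma J_le_k: "J \<le> k"
proof -
  have "J * 1 \<le> J * q" using q by (intro mult_le_mono) auto
  then show ?thesis using Jq_le_k by linarith
qed

lemma k_ge: "12 \<le> k"
  using J J_le_k by linarith

lemma real_k: "real k = (real J * real q)\<^sup>2"
  by (simp add: k_def)

lemma t_pos: "t > 0"
  using J q k_ge by (simp add: t_def)

lemma finite_C [simp]: "finite C"
  by (simp add: C_def)

lemma finite_P [simp]: "finite P"
  by (simp add: P_def)

lemma P_subset_C: "P \<subseteq> C"
  by (auto simp: P_def)

lemma w_pos: "w x > 0"
  by (simp add: w_def gauss_pos)

lemma w_uminus: "w (\<lambda>i. - x i) = w x"
  by (simp add: w_def gauss_uminus)

lemma Z_ge_k: "real k \<le> Z"
  unfolding Z_def using k_ge by (intro gauss_mass_ge) (auto simp: power2_eq_square)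

lemma Z_pos: "Z > 0"
  using Z_ge_k k_ge by linarith

lemma sum_w_C: "sum w C = Z ^ k"
  unfolding w_def C_def Z_def by (rule sum_gauss_cube)

lemma card_C_le: "card C \<le> (3 * k\<^sup>2) ^ k"
proof -
  have "1 \<le> k\<^sup>2" using k_ge by simp
  then have "card {- int (k\<^sup>2)..int (k\<^sup>2)} \<le> 3 * k\<^sup>2"
    unfolding card_atLeastAtMost_int by linarith
  then show ?thesis
    unfolding C_def card_lattice_box[OF finite_atLeastAtMost_int] by (intro power_mono) auto
qed

definition flat :: "(nat \<Rightarrow> int) set" where
  "flat = {x \<in> C. real_of_int (\<Sum>i<k. \<bar>x i\<bar>) < (real k)\<^sup>2 / (2 * real J)}"

lemma sum_w_flat_le: "sum w flat \<le> 6 / real J * Z ^ k"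
proof -
  \<comment> \<open>The coordinate threshold is \<open>r = k / J\<close>. Since \<open>r\<close> is
    at least 1, \<open>2 * (2 r + 1)\<close> is at most \<open>6 r\<close>, and the remaining
    \<open>k\<close> is absorbed by one factor \<open>Z\<close>.\<close>
  have "1 \<le> real k / real J" using J J_le_k by simp
  have "real k / real J * real k / 2 = (real k)\<^sup>2 / (2 * real J)" by (simp add: power2_eq_square)
  then have "sum w flat \<le> 2 * (2 * (real k / real J) + 1) * Z ^ (k - 1)"
    using sum_gauss_l1_small_le[of "real k / real J" k "real k" "k\<^sup>2"] J k_ge
    unfolding flat_def w_def C_def Z_def by simp
  also have "\<dots> \<le> (6 * (real k / real J)) * Z ^ (k - 1)"
    using \<open>1 \<le> real k / real J\<close> Z_pos by (intro mult_right_mono) auto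
  also have "\<dots> = 6 / real J * (real k * Z ^ (k - 1))" by simp
  also have "\<dots> \<le> 6 / real J * (Z * Z ^ (k - 1))"
    using Z_ge_k Z_pos by (intro mult_left_mono mult_right_mono) auto
  also have "Z * Z ^ (k - 1) = Z ^ k" using k_ge by (simp flip: power_Suc)
  finally show ?thesis .
qed

text \<open>Cauchy-Schwarz turns the l1 bound into a squared norm of at least
  \<open>k^3 / (4 J^2)\<close>, which equals \<open>k^2 q^2 / 4\<close> by the choice of
  \<open>k\<close> and exceeds \<open>9 t / 4\<close>.\<close>

lemma not_flat_in_P:
  assumes "x \<in> C" "x \<notin> flat"
  shows "x \<in> P"
proof -
  have pos: "real J > 0" "real q > 0" "real k > 0" using J q k_ge by auto
  have le: "(real k)\<^sup>2 / (2 * real J) \<le> (\<Sum>i<k. \<bar>real_of_int (x i)\<bar>)"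
    using assms by (auto simp: flat_def)
  have "((real k)\<^sup>2 / (2 * real J))\<^sup>2 \<le> (\<Sum>i<k. \<bar>real_of_int (x i)\<bar>)\<^sup>2"
    using le by (intro power_mono) auto
  also have "\<dots> \<le> (\<Sum>i<k. \<bar>real_of_int (x i)\<bar>\<^sup>2) * real (card {..<k})"
    by (rule sum_squared_le_sum_of_squares)
  also have "\<dots> = real_of_int (sq_norm k x) * real k" by (simp add: sq_norm_def)
  finally have "(real k)\<^sup>2 * real k * real k / (4 * (real J)\<^sup>2) \<le> real_of_int (sq_norm k x) * real k"
    by (simp add: power_divide power_mult_distrib power2_eq_square mult.assoc)
  then have "(real k)\<^sup>2 * real k / (4 * (real J)\<^sup>2) * real k \<le> real_of_int (sq_norm k x) * real k"
    by simp
  then have "(real k)\<^sup>2 * real k / (4 * (real J)\<^sup>2) \<le> real_of_int (sq_norm k x)"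
    using pos by (simp only: mult_le_cancel_right_pos)
  moreover have "(real k)\<^sup>2 * real k / (4 * (real J)\<^sup>2) = (real k)\<^sup>2 * (real q)\<^sup>2 / 4"
    using pos by (subst (2) real_k) (simp add: power_mult_distrib)
  moreover have "9 * t < (real k)\<^sup>2 * (real q)\<^sup>2"
  proof -
    have "9 * 1 < 2 * real J * real q" using J q by (intro mult_strict_mono) auto
    then have "9 * (real q * (real k)\<^sup>2) < 2 * real J * real q * (real q * (real k)\<^sup>2)"
      using pos by simp
    then show ?thesis using pos by (simp add: t_def field_simps power2_eq_square)
  qed
  ultimately show ?thesis using assms(1) by (simp add: P_def)
qed

lemma sum_w_outside_P_le: "sum w (C - P) \<le> 6 / real J * Z ^ k"
proof -
  have "sum w (C - P) \<le> sum w flat"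
    using not_flat_in_P by (intro sum_mono2) (auto simp: flat_def less_imp_le[OF w_pos])
  with sum_w_flat_le show ?thesis by linarith
qed

lemma sum_w_P: "Z ^ k / 2 \<le> sum w P" "sum w P \<le> Z ^ k"
proof -
  have "sum w C = sum w P + sum w (C - P)"
    using P_subset_C by (simp add: sum.subset_diff)
  moreover have "6 / real J * Z ^ k \<le> 1 / 2 * Z ^ k"
    using J Z_pos by (intro mult_right_mono) (auto simp: field_simps)
  ultimately show "Z ^ k / 2 \<le> sum w P" using sum_w_outside_P_le sum_w_C by linarith
  show "sum w P \<le> Z ^ k"
    unfolding sum_w_C[symmetric] using P_subset_C by (intro sum_mono2) (auto simp: less_imp_le[OF w_pos])
qed

lemma sum_w_slab_le:
  assumes "y \<in> C" "y \<notin> flat"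
  shows "sum w {x \<in> C. \<bar>real_of_int (dot k x y)\<bar> \<le> t / 4} \<le> 6 / real J * Z ^ k"
proof -
  have pos: "real J > 0" "real q > 0" "real k > 0" using J q k_ge by auto
  \<comment> \<open>Following the signs of \<open>y\<close> makes the inner product equal to
    \<open>q\<close> times the l1 norm of \<open>y\<close>. The squared norm of \<open>J u\<close>
    is at most \<open>J^2 q^2 k = k^2\<close>, the squared standard deviation.\<close>
  define u where "u i = (if i < k then sgn (y i) * int q else 0)" for i
  have "real J * sum w {x \<in> C. \<bar>real_of_int (dot k x y)\<bar> \<le> t / 4}
      \<le> exp (1 / 2) * gauss_mass (real k) (k\<^sup>2 + k) ^ k"
    unfolding w_def C_def
  proof (rule gauss_slab_anticoncentration)
    show "\<bar>u i\<bar> \<le> int q" for i by (auto simp: u_def abs_mult sgn_if)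
    have "sq_norm k u \<le> (\<Sum>i<k. (int q)\<^sup>2)"
      unfolding sq_norm_def by (intro sum_mono) (auto simp: u_def sgn_if)
    then have "int J ^ 2 * sq_norm k u \<le> int J ^ 2 * (int k * (int q)\<^sup>2)"
      by (intro mult_left_mono) auto
    also have "\<dots> = (int k)\<^sup>2"
      by (simp add: k_def power2_eq_square)
    finally show "real_of_int (int J ^ 2 * sq_norm k u) \<le> (real k)\<^sup>2"
      by (metis of_int_le_iff of_int_of_nat_eq of_int_power)
    have "dot k u y = int q * (\<Sum>i<k. \<bar>y i\<bar>)"
      unfolding dot_def sum_distrib_left by (intro sum.cong) (auto simp: u_def sgn_if)
    then have "real_of_int (dot k u y) = real q * real_of_int (\<Sum>i<k. \<bar>y i\<bar>)" by simp
    also have "\<dots> \<ge> real q * ((real k)\<^sup>2 / (2 * real J))"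
      using assms by (intro mult_left_mono) (auto simp: flat_def)
    also have "real q * ((real k)\<^sup>2 / (2 * real J)) = t" by (simp add: t_def)
    finally show "2 * (t / 4) < real_of_int (dot k u y)" using t_pos by linarith
    show "k\<^sup>2 + J * q \<le> k\<^sup>2 + k" using Jq_le_k by simp
  qed (use k_ge t_pos in \<open>auto simp: u_def\<close>)
  also have "\<dots> \<le> exp (1 / 2) * (1 + Z) ^ k"
  proof (intro mult_left_mono power_mono)
    show "gauss_mass (real k) (k\<^sup>2 + k) \<le> 1 + Z"
      unfolding Z_def using k_ge by (intro gauss_mass_enlarge_le) auto
    show "0 \<le> gauss_mass (real k) (k\<^sup>2 + k)"
      unfolding gauss_mass_def by (intro sum_nonneg less_imp_le[OF gauss1_pos])
  qed auto
  also have "\<dots> \<le> exp (1 / 2) * (exp 1 * Z ^ k)"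
    using one_plus_power_le_exp[of k Z] Z_ge_k k_ge by (intro mult_left_mono) auto
  also have "\<dots> \<le> 2 * (3 * Z ^ k)"
  proof (intro mult_mono)
    have "exp (1 / 2 :: real) ^ 2 = exp 1" by (simp flip: exp_of_nat_mult)
    then have "exp (1 / 2 :: real) ^ 2 \<le> 2 ^ 2" using exp_le by simp
    then show "exp (1 / 2 :: real) \<le> 2" by (rule power2_le_imp_le) simp
  qed (use exp_le Z_pos in auto)
  finally show ?thesis using pos by (simp add: field_simps)
qed

text \<open>Points \<open>y\<close> outside \<open>flat\<close> satisfy the slab estimate; for the
  others the trivial bound is enough because \<open>flat\<close> itself has small mass. Each case
  contributes \<open>6 / J\<close>.\<close>

lemma sum_slab_pairs_le:
  "(\<Sum>y\<in>C. w y * sum w {x \<in> C. \<bar>real_of_int (dot k x y)\<bar> \<le> t / 4}) \<le> 12 / real J * (Z ^ k)\<^sup>2"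
proof -
  let ?s = "\<lambda>y. sum w {x \<in> C. \<bar>real_of_int (dot k x y)\<bar> \<le> t / 4}"
  have Zk: "Z ^ k > 0" using Z_pos by simp
  have s: "?s y \<le> Z ^ k" for y
    unfolding sum_w_C[symmetric] by (intro sum_mono2) (auto simp: less_imp_le[OF w_pos])
  have flat: "flat \<subseteq> C" by (auto simp: flat_def)
  then have "(\<Sum>y\<in>C. w y * ?s y) = (\<Sum>y\<in>C - flat. w y * ?s y) + (\<Sum>y\<in>flat. w y * ?s y)"
    by (intro sum.subset_diff) auto
  also have "(\<Sum>y\<in>C - flat. w y * ?s y) \<le> (\<Sum>y\<in>C - flat. w y * (6 / real J * Z ^ k))"
    by (intro sum_mono mult_left_mono sum_w_slab_le) (auto simp: less_imp_le[OF w_pos])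
  also have "\<dots> \<le> (\<Sum>y\<in>C. w y * (6 / real J * Z ^ k))"
    using Zk by (intro sum_mono2) (auto simp: less_imp_le[OF w_pos])
  also have "\<dots> = 6 / real J * (Z ^ k)\<^sup>2"
    unfolding sum_distrib_right[symmetric] sum_w_C by (simp add: power2_eq_square)
  also have "(\<Sum>y\<in>flat. w y * ?s y) \<le> (\<Sum>y\<in>flat. w y * Z ^ k)"
    by (intro sum_mono mult_left_mono s) (auto simp: less_imp_le[OF w_pos])
  also have "\<dots> = sum w flat * Z ^ k" by (rule sum_distrib_right[symmetric])
  also have "\<dots> \<le> 6 / real J * Z ^ k * Z ^ k"
    using Zk sum_w_flat_le by (intro mult_right_mono) auto
  finally show ?thesis by (simp add: power2_eq_square)
qed

text \<open>Negation of \<open>x\<close> exchanges the two regions outside the slab, so each carries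
  half of the remaining mass.\<close>

lemma sum_w_acute:
  "2 * sum w {x \<in> C. acute x y} = Z ^ k - sum w {x \<in> C. \<bar>real_of_int (dot k x y)\<bar> \<le> t / 4}"
proof -
  let ?S = "{x \<in> C. \<bar>real_of_int (dot k x y)\<bar> \<le> t / 4}" and ?A = "{x \<in> C. acute x y}"
    and ?O = "{x \<in> C. acute (\<lambda>i. - x i) y}"
  have "sum w ?O = sum w ?A"
    by (rule sum.reindex_bij_witness[of _ "\<lambda>x i. - x i" "\<lambda>x i. - x i"])
      (use uminus_in_cube[of _ "k\<^sup>2" k] in \<open>auto simp: w_uminus C_def simp del: of_nat_power\<close>)
  moreover have "sum w C = sum w ?S + (sum w ?A + sum w ?O)"
  proof -
    have "C = ?S \<union> (?A \<union> ?O)" by (auto simp: acute_def dot_uminus)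
    then have "sum w C = sum w (?S \<union> (?A \<union> ?O))" by (rule arg_cong)
    also have "\<dots> = sum w ?S + sum w (?A \<union> ?O)"
      by (rule sum.union_disjoint) (auto simp: acute_def dot_uminus)
    also have "sum w (?A \<union> ?O) = sum w ?A + sum w ?O"
      using t_pos by (intro sum.union_disjoint) (auto simp: acute_def dot_uminus)
    finally show ?thesis .
  qed
  ultimately show ?thesis using sum_w_C by linarith
qed

lemma sum_acute_C_ge:
  "(1 / 2 - 6 / real J) * (Z ^ k)\<^sup>2 \<le> (\<Sum>(x, y)\<in>{(x, y) \<in> C \<times> C. acute x y}. w x * w y)"
proof -
  have eq: "{(x, y) \<in> C \<times> C. acute x y} = prod.swap ` (SIGMA y:C. {x \<in> C. acute x y})" by auto
  have "(\<Sum>(x, y)\<in>{(x, y) \<in> C \<times> C. acute x y}. w x * w y) = (\<Sum>y\<in>C. \<Sum>x\<in>{x \<in> C. acute x y}. w x * w y)"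
    unfolding eq by (subst sum.reindex) (auto simp: sum.Sigma case_prod_beta')
  also have "\<dots> = (\<Sum>y\<in>C. w y * sum w {x \<in> C. acute x y})"
    by (simp add: sum_distrib_left mult.commute)
  finally have "2 * (\<Sum>(x, y)\<in>{(x, y) \<in> C \<times> C. acute x y}. w x * w y)
      = (\<Sum>y\<in>C. w y * (2 * sum w {x \<in> C. acute x y}))"
    by (simp add: sum_distrib_left algebra_simps)
  also have "\<dots> = sum w C * Z ^ k - (\<Sum>y\<in>C. w y * sum w {x \<in> C. \<bar>real_of_int (dot k x y)\<bar> \<le> t / 4})"
    unfolding sum_w_acute right_diff_distrib sum_subtractf sum_distrib_right ..
  finally show ?thesis
    using sum_slab_pairs_le unfolding sum_w_C by (simp add: power2_eq_square algebra_simps)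
qed

text \<open>Discarding \<open>C - P\<close> in either coordinate costs \<open>6 / J\<close> each
  time, on top of the \<open>6 / J\<close> already lost to slabs.\<close>

lemma sum_acute_P_ge:
  "(1 / 2 - 18 / real J) * (Z ^ k)\<^sup>2 \<le> (\<Sum>(x, y)\<in>{(x, y) \<in> P \<times> P. acute x y}. w x * w y)"
proof -
  let ?f = "\<lambda>(x, y). w x * w y"
  have Zk: "Z ^ k > 0" using Z_pos by simp
  have nn: "?f z \<ge> 0" for z by (auto simp: case_prod_beta less_imp_le[OF w_pos])
  have fin: "finite {(x, y) \<in> P \<times> P. acute x y}"
    by (rule finite_subset[of _ "P \<times> P"]) auto
  have "sum ?f {(x, y) \<in> C \<times> C. acute x y}
      \<le> sum ?f ({(x, y) \<in> P \<times> P. acute x y} \<union> ((C - P) \<times> C \<union> C \<times> (C - P)))"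
    using fin by (intro sum_mono2 nn) auto
  also have "\<dots> \<le> sum ?f {(x, y) \<in> P \<times> P. acute x y} + sum ?f ((C - P) \<times> C \<union> C \<times> (C - P))"
    using fin sum.union_inter[of "{(x, y) \<in> P \<times> P. acute x y}" "(C - P) \<times> C \<union> C \<times> (C - P)" ?f]
      sum_nonneg[of "{(x, y) \<in> P \<times> P. acute x y} \<inter> ((C - P) \<times> C \<union> C \<times> (C - P))" ?f] nn by simp
  also have "sum ?f ((C - P) \<times> C \<union> C \<times> (C - P)) \<le> sum ?f ((C - P) \<times> C) + sum ?f (C \<times> (C - P))"
    using sum.union_inter[of "(C - P) \<times> C" "C \<times> (C - P)" ?f]
      sum_nonneg[of "(C - P) \<times> C \<inter> C \<times> (C - P)" ?f] nn by simp
  also have "sum ?f ((C - P) \<times> C) = sum w (C - P) * Z ^ k"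
    unfolding sum_w_C[symmetric] sum_product sum.cartesian_product ..
  also have "sum ?f (C \<times> (C - P)) = Z ^ k * sum w (C - P)"
    unfolding sum_w_C[symmetric] sum_product sum.cartesian_product ..
  finally have "sum ?f {(x, y) \<in> C \<times> C. acute x y}
      \<le> sum ?f {(x, y) \<in> P \<times> P. acute x y} + 2 * (sum w (C - P) * Z ^ k)"
    by (simp add: mult.commute[of "Z ^ k"])
  moreover have "sum w (C - P) * Z ^ k \<le> 6 / real J * Z ^ k * Z ^ k"
    using Zk sum_w_outside_P_le by (intro mult_right_mono) auto
  ultimately show ?thesis
    using sum_acute_C_ge by (simp add: power2_eq_square algebra_simps)
qed

definition \<nu> :: "(nat \<Rightarrow> int) \<Rightarrow> real" where "\<nu> x = w x / sum w P"

text \<open>In the constant 6, a factor 3 bounds the \<open>exp 1\<close> from replacing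
  \<open>1 + Z\<close> by \<open>Z\<close>, and a factor 2 comes from normalising by
  \<open>sum w P\<close>, which is at least half of the total mass.\<close>

lemma weighted_template_gaussian:
  "weighted_template P \<nu> near_antipodal acute (6 * exp (- real q / (16 * real J)))"
proof
  have Zk: "Z ^ k > 0" using Z_pos by simp
  then have wP: "sum w P > 0" using sum_w_P(1) by linarith
  show "finite P" by simp
  show "0 \<le> \<nu> x" for x using wP by (simp add: \<nu>_def less_imp_le[OF w_pos])
  show "sum \<nu> P = 1" using wP by (simp add: \<nu>_def flip: sum_divide_distrib)
  show "near_antipodal y x" if "near_antipodal x y" for x y
    using that by (simp add: near_antipodal_def add.commute)
  have no_triangle: False
    if x: "x \<in> P" and near: "near_antipodal x y" "near_antipodal y z" "near_antipodal x z" for x y z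
  proof -
    have "real_of_int (4 * sq_norm k x) \<le> real_of_int (3 * (sq_norm k (\<lambda>i. x i + y i) +
        sq_norm k (\<lambda>i. y i + z i) + sq_norm k (\<lambda>i. x i + z i)))"
      using four_sq_norm_le by (simp only: of_int_le_iff)
    then show False using x near by (simp add: P_def near_antipodal_def)
  qed
  \<comment> \<open>A loop is a degenerate triangle with all three points equal.\<close>
  then show "\<not> near_antipodal x x" if "x \<in> P" for x using that by blast
  show False if "x \<in> P" "near_antipodal x y" "near_antipodal y z" "near_antipodal x z" for x y z
    using no_triangle that by blast
  show False if "near_antipodal x x'" "near_antipodal y y'" "acute x y" "acute x y'" "acute x' y" "acute x' y'"
    for x x' y y'
  proof -
    have "real_of_int (2 * dot k (\<lambda>i. x i + x' i) (\<lambda>i. y i + y' i))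
        \<le> real_of_int (sq_norm k (\<lambda>i. x i + x' i) + sq_norm k (\<lambda>i. y i + y' i))"
      using two_dot_le by (simp only: of_int_le_iff)
    then show False using that unfolding dot_add_add by (simp add: near_antipodal_def acute_def)
  qed
  show "sum \<nu> A \<le> 6 * exp (- real q / (16 * real J))"
    if A: "A \<subseteq> P" and free: "\<And>x y. x \<in> A \<Longrightarrow> y \<in> A \<Longrightarrow> \<not> near_antipodal x y" for A
  proof -
    have "sum w A \<le> exp (- t / (8 * (real k)\<^sup>2)) * (1 + Z) ^ k"
      unfolding w_def Z_def
    proof (rule gauss_concentration)
      show "A \<subseteq> cube (k\<^sup>2) k" using A P_subset_C by (auto simp: C_def)
      show "t \<le> real_of_int (sq_norm k (\<lambda>i. x i + y i))" if "x \<in> A" "y \<in> A" for x y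
        using free[OF that] by (simp add: near_antipodal_def)
    qed (use k_ge in auto)
    also have "- t / (8 * (real k)\<^sup>2) = - real q / (16 * real J)"
      using k_ge by (simp add: t_def)
    also have "exp (- real q / (16 * real J)) * (1 + Z) ^ k \<le> exp (- real q / (16 * real J)) * (3 * Z ^ k)"
    proof (intro mult_left_mono)
      have "(1 + Z) ^ k \<le> exp 1 * Z ^ k" using k_ge Z_ge_k by (intro one_plus_power_le_exp) auto
      also have "\<dots> \<le> 3 * Z ^ k" using exp_le Zk by (intro mult_right_mono) auto
      finally show "(1 + Z) ^ k \<le> 3 * Z ^ k" .
    qed auto
    also have "\<dots> \<le> exp (- real q / (16 * real J)) * (3 * (2 * sum w P))"
      using sum_w_P(1) by (intro mult_left_mono) auto
    finally show ?thesis using wP by (simp add: \<nu>_def field_simps flip: sum_divide_distrib)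
  qed
qed

lemma card_P_le: "card P \<le> (3 * k\<^sup>2) ^ k"
  using card_mono[OF finite_C P_subset_C] card_C_le by linarith

lemma sum_acute_nu_ge:
  assumes "36 \<le> J"
  shows "1 / 2 - 18 / real J \<le> (\<Sum>(x, y)\<in>{(x, y) \<in> P \<times> P. acute x y}. \<nu> x * \<nu> y)"
proof -
  have Zk: "Z ^ k > 0" using Z_pos by simp
  then have wP: "sum w P > 0" using sum_w_P(1) by linarith
  \<comment> \<open>The coefficient is nonnegative because \<open>J\<close> is at least 36.\<close>
  have "(1 / 2 - 18 / real J) * (sum w P)\<^sup>2 \<le> (1 / 2 - 18 / real J) * (Z ^ k)\<^sup>2"
    using assms sum_w_P(2) wP by (intro mult_left_mono power_mono) (auto simp: field_simps)
  also note sum_acute_P_ge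
  finally have "1 / 2 - 18 / real J \<le> (\<Sum>(x, y)\<in>{(x, y) \<in> P \<times> P. acute x y}. w x * w y) / (sum w P)\<^sup>2"
    using wP by (simp add: field_simps)
  also have "\<dots> = (\<Sum>(x, y)\<in>{(x, y) \<in> P \<times> P. acute x y}. \<nu> x * \<nu> y)"
    by (simp add: \<nu>_def sum_divide_distrib case_prod_beta' power2_eq_square)
  finally show ?thesis .
qed

end

section \<open>The lower bound on the Ramsey--Turan number\<close>

text \<open>The admissible edge counts are bounded by \<open>n choose 2\<close>, so the
  \<open>Max\<close> defining \<open>RT\<close> is taken over a finite set, which \<open>G\<close>
  shows to be nonempty.\<close>

lemma card_edges_le_RT:
  fixes G :: "nat ugraph"
  assumes "finite_simple_graph G" "card (verts G) = n" "independence_number G < m" "\<not> contains_copy G H"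
  shows "card (edges G) \<le> RT n H m"
proof -
  let ?C = "{card (edges G) |G :: nat ugraph.
     finite_simple_graph G \<and> card (verts G) = n \<and> independence_number G < m \<and> \<not> contains_copy G H}"
  have "card (edges G) \<le> n choose 2" if "finite_simple_graph G" "card (verts G) = n" for G :: "nat ugraph"
    using that card_mono[of "[verts G]\<^bsup>2\<^esup>" "edges G"] finite_imp_finite_nsets[of "verts G" 2]
    by (simp add: finite_simple_graph_def card_nsets)
  then have "?C \<subseteq> {..n choose 2}" by blast
  then have "finite ?C" using finite_subset by blast
  moreover have "card (edges G) \<in> ?C" using assms by blast
  ultimately show ?thesis unfolding RT_def by (rule Max_ge)
qed

text \<open>Write \<open>L = ln n\<close>. The bound on \<open>k\<close> gives
  \<open>3 k^2 \<le> L^2\<close>, so the number of points is at most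
  \<open>L ^ (2 k) = exp (2 k ln L)\<close>, where \<open>2 k ln L \<le> L / 8\<close>.\<close>

lemma (in gaussian_parameters) card_P_le_powr:
  assumes n: "0 < n" and L: "1 \<le> ln (ln (real n))" and k: "real k * (16 * ln (ln (real n))) \<le> ln (real n)"
  shows "real (card P) \<le> real n powr (1 / 8)"
proof -
  let ?L = "ln (real n)"
  have "0 < real k * (16 * ln ?L)" using L k_ge by simp
  then have Lpos: "?L > 0" using k by linarith
  have "real k * 16 \<le> real k * (16 * ln ?L)" using L by (intro mult_left_mono) auto
  then have kL: "real k * 16 \<le> ?L" using k by linarith
  have "3 * (real k)\<^sup>2 \<le> (real k * 16)\<^sup>2" by (simp add: power_mult_distrib)
  also have "\<dots> \<le> ?L\<^sup>2" using kL by (intro power_mono) auto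
  finally have k2: "3 * (real k)\<^sup>2 \<le> ?L\<^sup>2" .
  have "real (card P) \<le> real ((3 * k\<^sup>2) ^ k)" using card_P_le by (simp only: of_nat_le_iff)
  also have "\<dots> = (3 * (real k)\<^sup>2) ^ k" by simp
  also have "\<dots> \<le> (?L\<^sup>2) ^ k" using k2 by (intro power_mono) auto
  also have "?L\<^sup>2 = exp (2 * ln ?L)"
    using Lpos by (simp add: exp_double)
  also have "exp (2 * ln ?L) ^ k = exp (real k * (2 * ln ?L))" by (simp flip: exp_of_nat_mult)
  also have "\<dots> \<le> exp (1 / 8 * ?L)" using k by simp
  also have "\<dots> = real n powr (1 / 8)" using n by (simp add: powr_def)
  finally show ?thesis .
qed

text \<open>With \<open>J\<close> fixed, \<open>q\<close> is taken near \<open>X n / (4 J)\<close>.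
  Then \<open>k = (J q)^2\<close> is at most \<open>X n ^ 2 / 16\<close>, small enough for the point
  count, while the independence ratio decays like \<open>exp (- X n / (64 J^2))\<close>, faster than
  \<open>exp (- f n)\<close>.\<close>

lemma RT_K4_eventually_ge:
  fixes f :: "nat \<Rightarrow> real" and m :: "nat \<Rightarrow> nat" and J :: nat
  assumes m: "\<And>n. m n = nat \<lfloor>exp (- f n) * real n\<rfloor>"
    and f: "(\<lambda>n. f n / (ln (real n) / ln (ln (real n))) powr (1/2)) \<longlonglongrightarrow> 0"
    and J36: "36 \<le> J"
  shows "\<forall>\<^sub>F n in sequentially. (1/8 - 6 / real J) * (real n)\<^sup>2 \<le> real (RT n (complete_graph 4) (m n))"
proof -
  define X where "X n = (ln (real n) / ln (ln (real n))) powr (1/2)" for n :: nat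
  \<comment> \<open>This is half of the decay rate \<open>1 / (64 J^2)\<close>: one half beats
    \<open>f n\<close>, the other absorbs the constants.\<close>
  define \<theta> where "\<theta> = 1 / (128 * (real J)\<^sup>2)"
  have Jpos: "real J > 0" using J36 by simp
  have \<theta>: "0 < \<theta>" "\<theta> \<le> 1"
  proof -
    have "1 \<le> (real J)\<^sup>2" using J36 by (intro one_le_power) simp
    then have "1 \<le> 128 * (real J)\<^sup>2" by linarith
    then show "\<theta> \<le> 1" unfolding \<theta>_def by (subst divide_le_eq_1_pos) linarith+
    show "0 < \<theta>" using Jpos by (simp add: \<theta>_def)
  qed
  have "filterlim X at_top sequentially" unfolding X_def by real_asymp
  \<comment> \<open>The constant is \<open>24 * 128\<close>, so that
    \<open>\<theta> * X n \<ge> 24\<close>.\<close>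
  then have E1: "\<forall>\<^sub>F n in sequentially. X n \<ge> 3072 * (real J)\<^sup>2"
    by (simp add: filterlim_at_top)
  have E2: "\<forall>\<^sub>F n in sequentially. ln (ln (real n)) \<ge> 1" by real_asymp
  \<comment> \<open>This leaves room for the uncoloured vertices; the 1 pays for the floor in
    \<open>m n\<close>.\<close>
  have E3: "\<forall>\<^sub>F n in sequentially. 2 * real n powr (1/8) + 1 \<le> exp (- X n) * real n / 2"
    unfolding X_def by real_asymp
  have E4: "\<forall>\<^sub>F n in sequentially. real n powr (1/8) \<le> 1 / real J * real n"
    using Jpos by real_asymp
  have E5: "\<forall>\<^sub>F n in sequentially. \<bar>f n / X n\<bar> < \<theta>"
    using order_tendstoD[OF tendsto_rabs_zero[OF f], of \<theta>] \<theta>(1) by (simp add: X_def)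
  have E6: "\<forall>\<^sub>F n in sequentially. n > 0" by (rule eventually_gt_at_top)
  show ?thesis
    using E1 E2 E3 E4 E5 E6
  proof eventually_elim
    fix n :: nat
    assume X: "X n \<ge> 3072 * (real J)\<^sup>2" and L: "ln (ln (real n)) \<ge> 1"
      and small: "2 * real n powr (1/8) + 1 \<le> exp (- X n) * real n / 2"
      and small': "real n powr (1/8) \<le> 1 / real J * real n"
      and f: "\<bar>f n / X n\<bar> < \<theta>" and n: "n > 0"
    define q where "q = nat \<lfloor>X n / (4 * real J)\<rfloor>"
    have XJ: "X n / (4 * real J) \<ge> 768 * real J"
      using X Jpos by (simp add: field_simps power2_eq_square)
    then have qX: "real q \<le> X n / (4 * real J)" "X n / (4 * real J) - 1 \<le> real q"
      using Jpos unfolding q_def by linarith+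
    have "real q \<ge> 5" using qX(2) XJ J36 by linarith
    then interpret gaussian_parameters J q using J36 by unfold_locales auto
    interpret weighted_template P \<nu> near_antipodal acute "6 * exp (- real q / (16 * real J))"
      by (rule weighted_template_gaussian)
    have Xpos: "X n > 0" using X Jpos by (smt (verit) zero_less_power mult_pos_pos)
    have Lpos: "ln (real n) > 0"
    proof -
      \<comment> \<open>A vanishing logarithm would make the quotient 0, and
        \<open>0 powr (1/2)\<close> is 0.\<close>
      have "ln (real n) / ln (ln (real n)) \<noteq> 0" using Xpos by (auto simp: X_def)
      moreover have "ln (real n) \<ge> 0" using n by simp
      ultimately show ?thesis by auto
    qed
    have X2: "(X n)\<^sup>2 = ln (real n) / ln (ln (real n))"
      using L Lpos by (simp add: X_def power2_eq_square flip: powr_add)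
    have "real k * 16 \<le> (X n)\<^sup>2"
    proof -
      have "4 * (real J * real q) \<le> X n" using qX(1) Jpos by (simp add: field_simps)
      then have "(4 * (real J * real q))\<^sup>2 \<le> (X n)\<^sup>2" by (intro power_mono) auto
      then show ?thesis unfolding real_k by (simp add: power_mult_distrib)
    qed
    then have "real k * (16 * ln (ln (real n))) \<le> ln (real n)"
      unfolding X2 using L by (simp add: field_simps)
    then have P: "real (card P) \<le> real n powr (1/8)"
      using card_P_le_powr[OF n L] by blast
    have fX: "f n \<le> \<theta> * X n" using f Xpos by (simp add: abs_less_iff field_simps)
    have mix: "real n * (6 * exp (- real q / (16 * real J))) \<le> exp (- \<theta> * X n) * real n / 2"
    proof -
      have "- real q / (16 * real J) \<le> 1 / 2 - 2 * \<theta> * X n"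
      proof -
        have "(X n / (4 * real J) - 1) / (16 * real J) \<le> real q / (16 * real J)"
          using qX(2) Jpos by (intro divide_right_mono) auto
        moreover have "(X n / (4 * real J) - 1) / (16 * real J) = 2 * \<theta> * X n - 1 / (16 * real J)"
          using Jpos by (simp add: \<theta>_def field_simps power2_eq_square)
        moreover have "1 / (16 * real J) \<le> 1 / 2" using J36 by (simp add: field_simps)
        ultimately show ?thesis by simp
      qed
      then have "exp (- real q / (16 * real J)) \<le> exp (1 / 2) * (exp (- \<theta> * X n) * exp (- \<theta> * X n))"
        by (simp flip: exp_add)
      \<comment> \<open>One of the two decay factors is traded for 1/24, since
        \<open>6 * 2 / 24 = 1 / 2\<close>.\<close>
      also have "\<dots> \<le> 2 * (exp (- \<theta> * X n) * (1 / 24))"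
      proof (intro mult_mono)
        have "exp (1 / 2 :: real) ^ 2 = exp 1" by (simp flip: exp_of_nat_mult)
        then have "exp (1 / 2 :: real) ^ 2 \<le> 2 ^ 2" using exp_le by simp
        then show "exp (1 / 2 :: real) \<le> 2" by (rule power2_le_imp_le) simp
        have "24 \<le> \<theta> * X n" using X Jpos by (simp add: \<theta>_def field_simps)
        then have "24 \<le> exp (\<theta> * X n)" using exp_ge_add_one_self[of "\<theta> * X n"] by linarith
        then show "exp (- \<theta> * X n) \<le> 1 / 24" by (simp add: exp_minus field_simps)
      qed auto
      finally have "6 * exp (- real q / (16 * real J)) \<le> exp (- \<theta> * X n) / 2" by simp
      then have "real n * (6 * exp (- real q / (16 * real J))) \<le> real n * (exp (- \<theta> * X n) / 2)"
        by (intro mult_left_mono) auto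
      then show ?thesis by (simp add: mult.commute)
    qed
    have "exp (- X n) * real n / 2 \<le> exp (- \<theta> * X n) * real n / 2"
      using \<theta> Xpos by (intro divide_right_mono mult_right_mono) auto
    moreover have "exp (- \<theta> * X n) * real n \<le> exp (- f n) * real n"
      using fX by (intro mult_right_mono) auto
    ultimately have bound: "real n * (6 * exp (- real q / (16 * real J))) + 2 * real (card P) + 1 \<le> exp (- f n) * real n"
      using mix small P by linarith
    obtain G :: "nat ugraph" where G: "finite_simple_graph G" "card (verts G) = n"
        "\<not> contains_copy G (complete_graph 4)"
      and ind: "real (independence_number G) \<le> real n * (6 * exp (- real q / (16 * real J))) + 2 * real (card P)"
      and edges: "(real n)\<^sup>2 / 4 * (\<Sum>(p, r)\<in>{(p, r) \<in> P \<times> P. acute p r}. \<nu> p * \<nu> r) - real n * real (card P)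
        \<le> real (card (edges G))"
      using exists_blow_up[of n] by blast
    have "independence_number G < m n" using ind bound unfolding m by linarith
    then have "real (card (edges G)) \<le> real (RT n (complete_graph 4) (m n))"
      using card_edges_le_RT[OF G(1,2) _ G(3)] by simp
    moreover have "(real n)\<^sup>2 / 4 * (1 / 2 - 18 / real J)
        \<le> (real n)\<^sup>2 / 4 * (\<Sum>(p, r)\<in>{(p, r) \<in> P \<times> P. acute p r}. \<nu> p * \<nu> r)"
      using sum_acute_nu_ge[OF J36] by (intro mult_left_mono) auto
    moreover have "real n * real (card P) \<le> 1 / real J * (real n)\<^sup>2"
    proof -
      have "real n * real (card P) \<le> real n * (1 / real J * real n)"
        using P small' by (intro mult_left_mono) auto
      then show ?thesis by (simp add: power2_eq_square)
    qed
    \<comment> \<open>The losses are \<open>18 / (4 J)\<close> from the density and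
      \<open>1 / J\<close> from rounding, together \<open>5.5 / J\<close>.\<close>
    moreover have "(1/8 - 6 / real J) * (real n)\<^sup>2 \<le> (real n)\<^sup>2 / 4 * (1 / 2 - 18 / real J) - 1 / real J * (real n)\<^sup>2"
      using Jpos by (simp add: field_simps)
    ultimately show "(1/8 - 6 / real J) * (real n)\<^sup>2 \<le> real (RT n (complete_graph 4) (m n))"
      using edges by linarith
  qed
qed

theorem theorem1p10:
  fixes f :: "nat \<Rightarrow> real" and m :: "nat \<Rightarrow> nat"
  assumes "\<And>n. m n = nat \<lfloor>exp (- f n) * real n\<rfloor>"
    and "(\<lambda>n. f n / (ln (real n) / ln (ln (real n))) powr (1/2)) \<longlonglongrightarrow> 0"
  shows "\<exists>\<epsilon> :: nat \<Rightarrow> real. \<epsilon> \<longlonglongrightarrow> 0 \<and>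
    (\<forall>\<^sub>F n in sequentially. real (RT n (complete_graph 4) (m n)) \<ge> (1/8 - \<epsilon> n) * (real n)\<^sup>2)"
proof -
  \<comment> \<open>With \<epsilon> chosen as the actual deficit, the inequality holds for every
    positive \<open>n\<close>. Convergence to 0 follows by choosing, for each tolerance
    \<open>a\<close>, a fixed \<open>J\<close> with \<open>6 / J < a\<close>.\<close>
  define \<epsilon> where "\<epsilon> n = max 0 (1/8 - real (RT n (complete_graph 4) (m n)) / (real n)\<^sup>2)" for n
  have "\<epsilon> \<longlonglongrightarrow> 0"
  proof (rule order_tendstoI)
    show "\<forall>\<^sub>F n in sequentially. a < \<epsilon> n" if "a < 0" for a
      using that by (intro always_eventually) (auto simp: \<epsilon>_def less_max_iff_disj)
    show "\<forall>\<^sub>F n in sequentially. \<epsilon> n < a" if a: "0 < a" for a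
    proof -
      obtain J0 :: nat where J0: "6 / a < real J0" using reals_Archimedean2 by blast
      define J where "J = max 36 J0"
      have "6 / a < real J" using J0 by (simp add: J_def)
      moreover have "real J \<ge> 36" by (simp add: J_def)
      ultimately have Ja: "6 / real J < a" using a by (simp add: field_simps)
      have "\<forall>\<^sub>F n in sequentially. (1/8 - 6 / real J) * (real n)\<^sup>2 \<le> real (RT n (complete_graph 4) (m n))"
        using assms by (rule RT_K4_eventually_ge) (simp add: J_def)
      then show ?thesis
        using eventually_gt_at_top[of 0]
      proof eventually_elim
        case (elim n)
        then have "1/8 - 6 / real J \<le> real (RT n (complete_graph 4) (m n)) / (real n)\<^sup>2"
          by (simp add: field_simps)
        then show ?case using Ja a by (simp add: \<epsilon>_def)
      qed
    qed
  qed
  moreover have "\<forall>\<^sub>F n in sequentially. real (RT n (complete_graph 4) (m n)) \<ge> (1/8 - \<epsilon> n) * (real n)\<^sup>2"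
    using eventually_gt_at_top[of 0]
  proof eventually_elim
    case (elim n)
    have "1/8 - \<epsilon> n \<le> real (RT n (complete_graph 4) (m n)) / (real n)\<^sup>2" by (simp add: \<epsilon>_def)
    then show ?case using elim by (simp add: pos_le_divide_eq)
  qed
  ultimately show ?thesis by blast
qed

end
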